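(* Let $\alpha\in(0,\infty)$ and $p\in[1,\infty)$ satisfy $2/p\le\alpha\le2$. Let $f:\mathbb{R}/\mathcal{L}\mathbb{Z}\to\mathbb{R}^n$ be an arclength parametrization of a closed curve without self-intersections. If $f,\phi,\psi\in C^{1,\alpha/2}(\mathbb{R}/\mathcal{L}\mathbb{Z},\mathbb{R}^n)$ and $f$ is bi-Lipschitz, then $\mathscr{M}_{(\alpha,p)}(f)$, $\mathscr{G}_{(\alpha,p)}(f)[\phi]$ and $\mathscr{H}_{(\alpha,p)}(f)[\phi,\psi]$ belong to $L^\infty((\mathbb{R}/\mathcal{L}\mathbb{Z})^2)$.
   Context: $\mathcal{L}>0$ is the length of the curve and $\tau=f'$. $\mathscr{D}(f(s_1),f(s_2))$ is the intrinsic distance, i.e. the length of the shorter arc of the curve between $f(s_1)$ and $f(s_2)$. $f$ is bi-Lipschitz if there is $C_{\mathrm b}>0$ with $\mathscr{D}(f(s_1),f(s_2))\le C_{\mathrm b}\|f(s_1)-f(s_2)\|_{\mathbb{R}^n}$ for all $s_1,s_2$. Energy density of a closed curve $f$: $$\mathscr{M}_{(\alpha,p)}(f)(s_1,s_2)=\left(\frac1{\|f(s_1)-f(s_2)\|_{\mathbb{R}^n}^\alpha}-\frac1{\mathscr{D}(f(s_1),f(s_2))^\alpha}\right)^p .$$ For a geometric quantity $\mathscr{F}(f)$, $\delta\mathscr{F}(f)[\phi]=\frac{d}{d\varepsilon}\mathscr{F}(f+\varepsilon\phi)|_{\varepsilon=0}$ and $\delta^2\mathscr{F}(f)[\phi,\psi]=\frac{\partial^2}{\partial\varepsilon_1\partial\varepsilon_2}\mathscr{F}(f+\varepsilon_1\phi+\varepsilon_2\psi)|_{\varepsilon_1=\varepsilon_2=0}$.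 The functions $\mathscr{G}_{(\alpha,p)}(f)[\phi]$ and $\mathscr{H}_{(\alpha,p)}(f)[\phi,\psi]$ of $(s_1,s_2)$ are defined by $$\mathscr{G}_{(\alpha,p)}(f)[\phi]\,ds_1ds_2=\delta(\mathscr{M}_{(\alpha,p)}(f)\,ds_1ds_2)[\phi],\qquad \mathscr{H}_{(\alpha,p)}(f)[\phi,\psi]\,ds_1ds_2=\delta^2(\mathscr{M}_{(\alpha,p)}(f)\,ds_1ds_2)[\phi,\psi].$$ Here the line elements are also varied: for a perturbed curve $g=f+\varepsilon\phi$ (or $g=f+\varepsilon_1\phi+\varepsilon_2\psi$), parametrized by the same parameter $s$, the distances in $\mathscr{M}_{(\alpha,p)}$ are those of $g$ and $ds_j$ is replaced by $\|g'(s_j)\|_{\mathbb{R}^n}ds_j$. Thus e.g. $\mathscr{G}_{(\alpha,p)}(f)[\phi](s_1,s_2)=\frac{d}{d\varepsilon}\big(\mathscr{M}_{(\alpha,p)}(f+\varepsilon\phi)(s_1,s_2)\,\|\tau(s_1)+\varepsilon\phi'(s_1)\|\,\|\tau(s_2)+\varepsilon\phi'(s_2)\|\big)|_{\varepsilon=0}$. For $\beta\in(0,1]$, $C^{1,\beta}$ is the space of $C^1$ functions $u$ with $\sup_{s_1\ne s_2}\|u'(s_1)-u'(s_2)\|/|s_1-s_2|^\beta<\infty$, where $|s_1-s_2|$ is the distance in $\mathbb{R}/\mathcal{L}\mathbb{Z}$. *)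

theory Defs
  imports
    "HOL-Analysis.Analysis"
    "HOL-Probability.Essential_Supremum"
    "HOL-Library.Periodic_Fun"
    "HOL-Library.Real_Mod"
begin

text \<open>
  A function on the circle \<open>\<real>/L\<int>\<close> is represented by the corresponding \<open>L\<close>-periodic function
  on \<open>\<real>\<close>.
\<close>

definition circle_dist :: "real \<Rightarrow> real \<Rightarrow> real \<Rightarrow> real" where
  "circle_dist L s t = (INF k::int. \<bar>s - t + of_int k * L\<bar>)"

text \<open>
  The bound in the last conjunct is required for all pairs of reals; if they represent the same
  point of the circle, it reads \<open>0 \<le> 0\<close> by periodicity, since \<open>0 powr \<beta> = 0\<close>.
\<close>

definition C1_holder :: "real \<Rightarrow> real \<Rightarrow> (real \<Rightarrow> 'a::real_normed_vector) \<Rightarrow> bool" where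
  "C1_holder L \<beta> u \<longleftrightarrow>
     periodic_fun_simple u L \<and> u C1_differentiable_on UNIV \<and>
     (\<exists>C. \<forall>s t. norm (vector_derivative u (at s) - vector_derivative u (at t))
                  \<le> C * circle_dist L s t powr \<beta>)"

definition arclength_parametrization :: "real \<Rightarrow> (real \<Rightarrow> 'a::real_normed_vector) \<Rightarrow> bool" where
  "arclength_parametrization L f \<longleftrightarrow>
     periodic_fun_simple f L \<and> f C1_differentiable_on UNIV \<and>
     (\<forall>s. norm (vector_derivative f (at s)) = 1)"

definition arc_length :: "(real \<Rightarrow> 'a::real_normed_vector) \<Rightarrow> real \<Rightarrow> real \<Rightarrow> real" where
  "arc_length g a b = integral {a..b} (\<lambda>s. norm (vector_derivative g (at s)))"

text \<open>
  The curve \<open>g\<close> need not be parametrized by arclength, as varied curves are not. Its two arcs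
  between the parameters \<open>s\<close> and \<open>t\<close> are those over \<open>[s, t']\<close> and \<open>[t', s + L]\<close>, where \<open>t'\<close> is
  the representative of \<open>t\<close> modulo \<open>L\<close> in \<open>[s, s + L)\<close>.
\<close>

definition intrinsic_dist :: "real \<Rightarrow> (real \<Rightarrow> 'a::real_normed_vector) \<Rightarrow> real \<Rightarrow> real \<Rightarrow> real" where
  "intrinsic_dist L g s t =
     (let t' = s + (t - s) rmod L in min (arc_length g s t') (arc_length g t' (s + L)))"

definition bi_lipschitz :: "real \<Rightarrow> (real \<Rightarrow> 'a::real_normed_vector) \<Rightarrow> bool" where
  "bi_lipschitz L f \<longleftrightarrow> (\<exists>C>0. \<forall>s t. intrinsic_dist L f s t \<le> C * norm (f s - f t))"

definition energy_density ::
  "real \<Rightarrow> real \<Rightarrow> real \<Rightarrow> (real \<Rightarrow> 'a::real_normed_vector) \<Rightarrow> real \<Rightarrow> real \<Rightarrow> real" where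
  "energy_density L \<alpha> p g s t =
     (1 / norm (g s - g t) powr \<alpha> - 1 / intrinsic_dist L g s t powr \<alpha>) powr p"

text \<open>
  The factor by which \<open>ds dt\<close> is multiplied in \<open>energy_density L \<alpha> p g ds dt\<close> when the line
  elements are those of \<open>g\<close>.
\<close>

definition energy_form ::
  "real \<Rightarrow> real \<Rightarrow> real \<Rightarrow> (real \<Rightarrow> 'a::real_normed_vector) \<Rightarrow> real \<Rightarrow> real \<Rightarrow> real" where
  "energy_form L \<alpha> p g s t =
     energy_density L \<alpha> p g s t
       * norm (vector_derivative g (at s)) * norm (vector_derivative g (at t))"

text \<open>
  Variations of a geometric quantity \<open>F\<close>. As \<^const>\<open>deriv\<close> is total, existence of the derivatives
  is a separate predicate. In the second variation the derivative in the direction \<open>\<psi>\<close> is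
  taken first.
\<close>

definition first_variation ::
  "((real \<Rightarrow> 'a::real_normed_vector) \<Rightarrow> real) \<Rightarrow> (real \<Rightarrow> 'a) \<Rightarrow> (real \<Rightarrow> 'a) \<Rightarrow> real" where
  "first_variation F f \<phi> = deriv (\<lambda>\<epsilon>. F (\<lambda>s. f s + \<epsilon> *\<^sub>R \<phi> s)) 0"

definition first_variation_exists ::
  "((real \<Rightarrow> 'a::real_normed_vector) \<Rightarrow> real) \<Rightarrow> (real \<Rightarrow> 'a) \<Rightarrow> (real \<Rightarrow> 'a) \<Rightarrow> bool" where
  "first_variation_exists F f \<phi> \<longleftrightarrow> (\<lambda>\<epsilon>. F (\<lambda>s. f s + \<epsilon> *\<^sub>R \<phi> s)) differentiable (at (0::real))"

definition second_variation ::
  "((real \<Rightarrow> 'a::real_normed_vector) \<Rightarrow> real) \<Rightarrow> (real \<Rightarrow> 'a) \<Rightarrow> (real \<Rightarrow> 'a) \<Rightarrow> (real \<Rightarrow> 'a) \<Rightarrow> real"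
  where
  "second_variation F f \<phi> \<psi> = first_variation (\<lambda>g. first_variation F g \<psi>) f \<phi>"

definition second_variation_exists ::
  "((real \<Rightarrow> 'a::real_normed_vector) \<Rightarrow> real) \<Rightarrow> (real \<Rightarrow> 'a) \<Rightarrow> (real \<Rightarrow> 'a) \<Rightarrow> (real \<Rightarrow> 'a) \<Rightarrow> bool"
  where
  "second_variation_exists F f \<phi> \<psi> \<longleftrightarrow>
     (\<forall>\<^sub>F \<epsilon> in nhds (0::real). first_variation_exists F (\<lambda>s. f s + \<epsilon> *\<^sub>R \<phi> s) \<psi>) \<and>
     first_variation_exists (\<lambda>g. first_variation F g \<psi>) f \<phi>"

definition energy_G ::
  "real \<Rightarrow> real \<Rightarrow> real \<Rightarrow> (real \<Rightarrow> 'a::real_normed_vector) \<Rightarrow> (real \<Rightarrow> 'a) \<Rightarrow> real \<Rightarrow> real \<Rightarrow> real"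
  where
  "energy_G L \<alpha> p f \<phi> s t = first_variation (\<lambda>g. energy_form L \<alpha> p g s t) f \<phi>"

definition energy_H ::
  "real \<Rightarrow> real \<Rightarrow> real \<Rightarrow> (real \<Rightarrow> 'a::real_normed_vector) \<Rightarrow> (real \<Rightarrow> 'a) \<Rightarrow> (real \<Rightarrow> 'a)
     \<Rightarrow> real \<Rightarrow> real \<Rightarrow> real"
  where
  "energy_H L \<alpha> p f \<phi> \<psi> s t = second_variation (\<lambda>g. energy_form L \<alpha> p g s t) f \<phi> \<psi>"

text \<open>Lebesgue measure on \<open>(\<real>/L\<int>)\<^sup>2\<close>, carried by a fundamental domain.\<close>

definition torus_measure :: "real \<Rightarrow> (real \<times> real) measure" where
  "torus_measure L = lebesgue_on ({0..<L} \<times> {0..<L})"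

definition L_infinity :: "'b measure \<Rightarrow> ('b \<Rightarrow> real) set" where
  "L_infinity M = {u \<in> borel_measurable M. esssup M (\<lambda>x. ereal \<bar>u x\<bar>) < \<infinity>}"

end

theory Submission
  imports Defs
begin

text \<open>
  Let \<open>[a, b]\<close> parametrize the shorter of the two arcs, \<open>h = b - a\<close>, and let \<open>v\<close> be the velocity of the
  (varied) curve. With means over \<open>[a, b]\<close>, the base of the energy density is
  \<open>X = h powr - \<alpha> * (norm (mean v) powr - \<alpha> - mean (norm v) powr - \<alpha>)\<close>. Since \<open>v\<close> and its variations
  oscillate by at most \<open>O(h powr (\<alpha> / 2))\<close> on the arc, a second order Taylor expansion at the mean,
  whose linear term averages to zero, shows that \<open>mean (norm v)\<close> and its first two variations differ
  from those of \<open>norm (mean v)\<close> by \<open>O(h powr \<alpha>)\<close> only. Bi-Lipschitz continuity keeps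
  \<open>norm (mean v)\<close> away from zero, so \<open>X\<close> and its first two variations are bounded uniformly, also
  along \<open>f + \<epsilon> \<phi>\<close> for small \<open>\<epsilon>\<close>.

  For \<open>p < 2\<close> the second variation of \<open>X powr p\<close> contains the singular factor \<open>X powr (p - 2)\<close>. A chord
  is never longer than an arc, so \<open>X \<ge> 0\<close> along all variations; a nonnegative function with bounded
  second derivative satisfies \<open>(X')\<^sup>2 \<le> C * X\<close>, which compensates that factor.
\<close>

text \<open>Two ranges of the variation parameter \<epsilon> must be kept apart. Derivatives exist
  pair by pair: near a pair with |s - t| = L / 2 an arbitrarily small variation can make the other
  arc the shorter one, so the range on which the chosen arc stays the shorter one shrinks there. The
  inequality for (X')^2, however, needs one range of \<epsilon> for all pairs. The estimates
  therefore follow the arc over a fixed interval [a, b], whether or not it stays the shorter one; a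
  chord is no longer than either arc, so X \<ge> 0 survives. The intrinsic distance is identified
  with this arc only afterwards, and only close to f.

  For 1 < p < 2 not only the size but the existence of the second variation is at stake: X may
  vanish, for instance on straight pieces, and u^p is not twice differentiable at 0. At such a pair
  X is minimal along every variation, so X' vanishes too, and this rescues the derivative of X^(p-1)
  X'.\<close>

section \<open>Functions with uniform second order Taylor bounds\<close>

text \<open>
  The set \<open>S\<close> need not be convex: all bounds are for pairs of points of \<open>S\<close>, so the segment between
  them plays no role. It will be a set of triples whose first component is bounded away from zero.
\<close>

definition c11_bound :: "'z::real_normed_vector set \<Rightarrow> real \<Rightarrow> ('z \<Rightarrow> real) \<Rightarrow> ('z \<Rightarrow> 'z \<Rightarrow> real) \<Rightarrow> bool"
  where
  "c11_bound S C K K' \<longleftrightarrow> 0 \<le> C \<and> (\<forall>z\<in>S. bounded_linear (K' z) \<and> \<bar>K z\<bar> \<le> C \<and>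
     (\<forall>w\<in>S. \<bar>K w - K z\<bar> \<le> C * norm (w - z) \<and> \<bar>K' z (w - z)\<bar> \<le> C * norm (w - z) \<and>
        \<bar>K w - K z - K' z (w - z)\<bar> \<le> C * (norm (w - z))\<^sup>2))"

definition c11_on :: "'z::real_normed_vector set \<Rightarrow> ('z \<Rightarrow> real) \<Rightarrow> bool" where
  "c11_on S K \<longleftrightarrow> (\<exists>C K'. c11_bound S C K K')"

lemma c11_onI:
  assumes "0 \<le> C" "\<And>z. z \<in> S \<Longrightarrow> bounded_linear (K' z)" "\<And>z. z \<in> S \<Longrightarrow> \<bar>K z\<bar> \<le> C"
    "\<And>z w. z \<in> S \<Longrightarrow> w \<in> S \<Longrightarrow> \<bar>K w - K z\<bar> \<le> C * norm (w - z)"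
    "\<And>z w. z \<in> S \<Longrightarrow> w \<in> S \<Longrightarrow> \<bar>K' z (w - z)\<bar> \<le> C * norm (w - z)"
    "\<And>z w. z \<in> S \<Longrightarrow> w \<in> S \<Longrightarrow> \<bar>K w - K z - K' z (w - z)\<bar> \<le> C * (norm (w - z))\<^sup>2"
  shows "c11_on S K"
  unfolding c11_on_def c11_bound_def using assms by (intro exI[of _ C] exI[of _ K']) blast

lemma c11_boundD:
  assumes "c11_bound S C K K'"
  shows "0 \<le> C" "\<And>z. z \<in> S \<Longrightarrow> bounded_linear (K' z)" "\<And>z. z \<in> S \<Longrightarrow> \<bar>K z\<bar> \<le> C"
    "\<And>z w. z \<in> S \<Longrightarrow> w \<in> S \<Longrightarrow> \<bar>K w - K z\<bar> \<le> C * norm (w - z)"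
    "\<And>z w. z \<in> S \<Longrightarrow> w \<in> S \<Longrightarrow> \<bar>K' z (w - z)\<bar> \<le> C * norm (w - z)"
    "\<And>z w. z \<in> S \<Longrightarrow> w \<in> S \<Longrightarrow> \<bar>K w - K z - K' z (w - z)\<bar> \<le> C * (norm (w - z))\<^sup>2"
  using assms unfolding c11_bound_def by blast+

lemma c11_on_diff:
  assumes "c11_on S K" "c11_on S H"
  shows "c11_on S (\<lambda>z. K z - H z)"
proof -
  obtain C K' where "c11_bound S C K K'" using assms(1) unfolding c11_on_def by blast
  note C = c11_boundD[OF this]
  obtain D H' where "c11_bound S D H H'" using assms(2) unfolding c11_on_def by blast
  note D = c11_boundD[OF this]
  show ?thesis
  proof (rule c11_onI[of "C + D" S "\<lambda>z d. K' z d - H' z d"])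
    fix z w assume zw: "z \<in> S" "w \<in> S"
    show "\<bar>K w - H w - (K z - H z)\<bar> \<le> (C + D) * norm (w - z)"
      using C(4)[OF zw] D(4)[OF zw] by (simp add: distrib_right)
    show "\<bar>K' z (w - z) - H' z (w - z)\<bar> \<le> (C + D) * norm (w - z)"
      using C(5)[OF zw] D(5)[OF zw] by (simp add: distrib_right)
    show "\<bar>K w - H w - (K z - H z) - (K' z (w - z) - H' z (w - z))\<bar> \<le> (C + D) * (norm (w - z))\<^sup>2"
      using C(6)[OF zw] D(6)[OF zw] by (simp add: distrib_right)
  next
    fix z assume z: "z \<in> S"
    show "\<bar>K z - H z\<bar> \<le> C + D" using C(3)[OF z] D(3)[OF z] by linarith
    show "bounded_linear (\<lambda>d. K' z d - H' z d)"
      using C(2)[OF z] D(2)[OF z] by (rule bounded_linear_sub)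
  qed (use C D in auto)
qed

lemma c11_on_mult:
  assumes "c11_on S K" "c11_on S H"
  shows "c11_on S (\<lambda>z. K z * H z)"
proof -
  obtain C K' where "c11_bound S C K K'" using assms(1) unfolding c11_on_def by blast
  note C = c11_boundD[OF this]
  obtain D H' where "c11_bound S D H H'" using assms(2) unfolding c11_on_def by blast
  note D = c11_boundD[OF this]
  show ?thesis
  proof (rule c11_onI[of "3 * (C * D)" S "\<lambda>z d. K' z d * H z + K z * H' z d"])
    fix z w assume zw: "z \<in> S" "w \<in> S"
    let ?d = "norm (w - z)"
    have CD: "0 \<le> C * D * ?d" using C(1) D(1) by simp
    have "K w * H w - K z * H z = (K w - K z) * H w + K z * (H w - H z)" by algebra
    also have "\<bar>\<dots>\<bar> \<le> (C * ?d) * D + C * (D * ?d)"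
      by (intro order_trans[OF abs_triangle_ineq] add_mono; unfold abs_mult)
        (intro mult_mono C D zw; simp add: C(1))+
    finally show "\<bar>K w * H w - K z * H z\<bar> \<le> 3 * (C * D) * ?d" using CD by (simp add: algebra_simps)
    have "\<bar>K' z (w - z) * H z + K z * H' z (w - z)\<bar> \<le> (C * ?d) * D + C * (D * ?d)"
      by (intro order_trans[OF abs_triangle_ineq] add_mono; unfold abs_mult)
        (intro mult_mono C D zw; simp add: C(1))+
    then show "\<bar>K' z (w - z) * H z + K z * H' z (w - z)\<bar> \<le> 3 * (C * D) * ?d"
      using CD by (simp add: algebra_simps)
    \<comment> \<open>The third term is a product of two first order quantities. It is the reason
      why \<open>c11_bound\<close> also bounds \<open>K' z (w - z)\<close> linearly.\<close>
    have "K w * H w - K z * H z - (K' z (w - z) * H z + K z * H' z (w - z))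
       = (K w - K z - K' z (w - z)) * H w + K z * (H w - H z - H' z (w - z))
         + K' z (w - z) * (H w - H z)" by algebra
    also have "\<bar>\<dots>\<bar> \<le> (C * ?d\<^sup>2) * D + C * (D * ?d\<^sup>2) + (C * ?d) * (D * ?d)"
      by (intro order_trans[OF abs_triangle_ineq] add_mono; unfold abs_mult)
        (intro mult_mono C D zw; simp add: C(1))+
    finally show "\<bar>K w * H w - K z * H z - (K' z (w - z) * H z + K z * H' z (w - z))\<bar>
        \<le> 3 * (C * D) * ?d\<^sup>2" by (simp add: algebra_simps power2_eq_square)
  next
    fix z assume z: "z \<in> S"
    have "\<bar>K z * H z\<bar> \<le> C * D" unfolding abs_mult by (intro mult_mono C D z; simp add: C(1))
    then show "\<bar>K z * H z\<bar> \<le> 3 * (C * D)" using mult_nonneg_nonneg[OF C(1) D(1)] by linarith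
    show "bounded_linear (\<lambda>d. K' z d * H z + K z * H' z d)"
      using C(2)[OF z] D(2)[OF z]
      by (intro bounded_linear_add bounded_linear_const_mult bounded_linear_mult_const)
  qed (use C D in auto)
qed

text \<open>The segment from \<open>z\<close> to \<open>w\<close> may leave \<open>S\<close>, so the
  mean value theorem cannot be used. Increment and remainder of the inverse are instead exact
  algebraic expressions in those of \<open>K\<close>, obtained from
  \<open>J z * K z = 1\<close>.\<close>

lemma c11_on_inverse:
  assumes "c11_on S K" "0 < c" "\<And>z. z \<in> S \<Longrightarrow> c \<le> K z"
  shows "c11_on S (\<lambda>z. inverse (K z))"
proof -
  obtain C K' where "c11_bound S C K K'" using assms(1) unfolding c11_on_def by blast
  note C = c11_boundD[OF this]
  define e where "e = inverse c"
  have e0: "0 \<le> e" using assms(2) by (simp add: e_def)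
  define J where "J z = inverse (K z)" for z
  have J: "0 \<le> J z" "\<bar>J z\<bar> \<le> e" "J z * K z = 1" if "z \<in> S" for z
    using assms(2) assms(3)[OF that] by (auto simp: e_def J_def intro!: le_imp_inverse_le)
  define D where "D = e + C * e\<^sup>2 + C\<^sup>2 * e ^ 3"
  have D: "e \<le> D" "C * e\<^sup>2 \<le> D" "C * e\<^sup>2 + C\<^sup>2 * e ^ 3 \<le> D"
    unfolding D_def using e0 C(1) by auto
  have "c11_on S J"
  proof (rule c11_onI[of D S "\<lambda>z d. - (K' z d * (J z * J z))"])
    fix z w assume zw: "z \<in> S" "w \<in> S"
    let ?d = "norm (w - z)"
    have JJ: "\<bar>J x * J y\<bar> \<le> e * e" if "x \<in> S" "y \<in> S" for x y
      unfolding abs_mult by (intro mult_mono J that; simp add: e0)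
    have "J w - J z = (K z - K w) * (J w * J z)" using J(3)[OF zw(1)] J(3)[OF zw(2)] by algebra
    also have "\<bar>\<dots>\<bar> \<le> (C * ?d) * (e * e)"
      unfolding abs_mult[of "K z - K w"] by (intro mult_mono JJ zw)
        (use C(4)[OF zw] C(1) in \<open>auto simp: abs_minus_commute\<close>)
    also have "\<dots> \<le> D * ?d" using mult_right_mono[OF D(2), of ?d] by (simp add: power2_eq_square mult_ac)
    finally show "\<bar>J w - J z\<bar> \<le> D * ?d" .
    have "\<bar>- (K' z (w - z) * (J z * J z))\<bar> \<le> (C * ?d) * (e * e)"
      unfolding abs_minus_cancel abs_mult[of "K' z (w - z)"] by (intro mult_mono JJ C zw)
        (use C(1) in auto)
    also have "\<dots> \<le> D * ?d" using mult_right_mono[OF D(2), of ?d] by (simp add: power2_eq_square mult_ac)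
    finally show "\<bar>- (K' z (w - z) * (J z * J z))\<bar> \<le> D * ?d" .
    \<comment> \<open>Substitute \<open>J w = J z - (K w - K z) * (J z * J w)\<close> into itself
      once; beyond the linear term only a term quadratic in the increment of \<open>K\<close>
      remains.\<close>
    have "J w - J z - (- (K' z (w - z) * (J z * J z)))
       = (K' z (w - z) - (K w - K z)) * (J z * J z) + ((K w - K z) * (K w - K z)) * ((J z * J z) * J w)"
      using J(3)[OF zw(1)] J(3)[OF zw(2)] by algebra
    also have "\<bar>\<dots>\<bar> \<le> (C * ?d\<^sup>2) * (e * e) + ((C * ?d) * (C * ?d)) * ((e * e) * e)"
    proof (intro order_trans[OF abs_triangle_ineq] add_mono)
      show "\<bar>(K' z (w - z) - (K w - K z)) * (J z * J z)\<bar> \<le> (C * ?d\<^sup>2) * (e * e)"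
        unfolding abs_mult[of "K' z (w - z) - (K w - K z)"] by (intro mult_mono JJ zw)
        (use C(6)[OF zw] C(1) in \<open>auto simp: abs_minus_commute\<close>)
      show "\<bar>((K w - K z) * (K w - K z)) * ((J z * J z) * J w)\<bar> \<le> ((C * ?d) * (C * ?d)) * ((e * e) * e)"
        unfolding abs_mult[of "(K w - K z) * (K w - K z)"] abs_mult[of "K w - K z"] abs_mult[of "J z * J z"]
        by (intro mult_mono JJ J C zw) (use C(1) e0 in auto)
    qed
    also have "\<dots> = (C * e\<^sup>2 + C\<^sup>2 * e ^ 3) * ?d\<^sup>2"
      by (simp add: power2_eq_square power3_eq_cube algebra_simps)
    also have "\<dots> \<le> D * ?d\<^sup>2" by (intro mult_right_mono D) simp
    finally show "\<bar>J w - J z - (- (K' z (w - z) * (J z * J z)))\<bar> \<le> D * ?d\<^sup>2" .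
  next
    fix z assume z: "z \<in> S"
    show "\<bar>J z\<bar> \<le> D" using J(2)[OF z] D(1) by linarith
    show "bounded_linear (\<lambda>d. - (K' z d * (J z * J z)))"
      using C(2)[OF z] by (intro bounded_linear_minus bounded_linear_mult_const)
  qed (use D(1) e0 in linarith)
  then show ?thesis unfolding J_def .
qed

text \<open>A bilinear form has as remainder the form evaluated at the two increments.\<close>

lemma c11_on_inner:
  fixes P Q :: "'z::real_normed_vector \<Rightarrow> 'a::real_inner"
  assumes P: "bounded_linear P" and Q: "bounded_linear Q" and S: "bounded S"
  shows "c11_on S (\<lambda>z. P z \<bullet> Q z)"
proof -
  obtain B1 where B1: "0 \<le> B1" "\<And>x. norm (P x) \<le> B1 * norm x"
    using bounded_linear.nonneg_bounded[OF P] by (auto simp: mult.commute)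
  obtain B2 where B2: "0 \<le> B2" "\<And>x. norm (Q x) \<le> B2 * norm x"
    using bounded_linear.nonneg_bounded[OF Q] by (auto simp: mult.commute)
  obtain R where R: "0 < R" "\<And>x. x \<in> S \<Longrightarrow> norm x \<le> R" using S unfolding bounded_pos by blast
  have PQ: "\<bar>P x \<bullet> Q y\<bar> \<le> B1 * B2 * (norm x * norm y)" for x y
  proof -
    have "\<bar>P x \<bullet> Q y\<bar> \<le> norm (P x) * norm (Q y)" by (rule Cauchy_Schwarz_ineq2)
    also have "\<dots> \<le> (B1 * norm x) * (B2 * norm y)" by (intro mult_mono B1 B2) (use B1(1) in auto)
    finally show ?thesis by (simp add: mult_ac)
  qed
  define B where "B = B1 * B2"
  have B: "0 \<le> B" using B1 B2 by (simp add: B_def)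
  have lip: "\<bar>P x \<bullet> Q d\<bar> \<le> B * (R * norm d)" "\<bar>P d \<bullet> Q x\<bar> \<le> B * (R * norm d)" if "x \<in> S" for x d
  proof -
    have "B * (norm x * norm d) \<le> B * (R * norm d)"
      using R(2)[OF that] B by (intro mult_left_mono mult_right_mono) auto
    then show "\<bar>P x \<bullet> Q d\<bar> \<le> B * (R * norm d)" "\<bar>P d \<bullet> Q x\<bar> \<le> B * (R * norm d)"
      using PQ[of x d] PQ[of d x] by (auto simp: B_def mult.commute)
  qed
  define C where "C = B * (R * R) + 2 * (B * R) + B"
  have C: "B * (R * R) \<le> C" "2 * (B * R) \<le> C" "B \<le> C" using B R by (auto simp: C_def)
  show ?thesis
  proof (rule c11_onI[of C S "\<lambda>z d. P d \<bullet> Q z + P z \<bullet> Q d"])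
    fix z w assume zw: "z \<in> S" "w \<in> S"
    let ?d = "norm (w - z)"
    have Pw: "P (w - z) = P w - P z" and Qw: "Q (w - z) = Q w - Q z"
      using P Q by (simp_all add: linear_diff bounded_linear.linear)
    have "P w \<bullet> Q w - P z \<bullet> Q z = P (w - z) \<bullet> Q w + P z \<bullet> Q (w - z)"
      unfolding Pw Qw by (simp add: inner_diff)
    also have "\<bar>\<dots>\<bar> \<le> 2 * (B * R) * ?d" using lip(2)[OF zw(2), of "w - z"] lip(1)[OF zw(1), of "w - z"]
      by linarith
    also have "\<dots> \<le> C * ?d" by (intro mult_right_mono C) simp
    finally show "\<bar>P w \<bullet> Q w - P z \<bullet> Q z\<bar> \<le> C * ?d" .
    have "\<bar>P (w - z) \<bullet> Q z + P z \<bullet> Q (w - z)\<bar> \<le> 2 * (B * R) * ?d"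
      using lip(2)[OF zw(1), of "w - z"] lip(1)[OF zw(1), of "w - z"] by linarith
    also have "\<dots> \<le> C * ?d" by (intro mult_right_mono C) simp
    finally show "\<bar>P (w - z) \<bullet> Q z + P z \<bullet> Q (w - z)\<bar> \<le> C * ?d" .
    have "P w \<bullet> Q w - P z \<bullet> Q z - (P (w - z) \<bullet> Q z + P z \<bullet> Q (w - z)) = P (w - z) \<bullet> Q (w - z)"
      unfolding Pw Qw by (simp add: inner_diff)
    also have "\<bar>\<dots>\<bar> \<le> B * ?d\<^sup>2" using PQ[of "w - z" "w - z"] by (simp add: B_def power2_eq_square)
    also have "\<dots> \<le> C * ?d\<^sup>2" by (intro mult_right_mono C) simp
    finally show "\<bar>P w \<bullet> Q w - P z \<bullet> Q z - (P (w - z) \<bullet> Q z + P z \<bullet> Q (w - z))\<bar> \<le> C * ?d\<^sup>2" .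
  next
    fix z assume z: "z \<in> S"
    have "\<bar>P z \<bullet> Q z\<bar> \<le> B * (R * norm z)" using lip(1)[OF z] .
    also have "\<dots> \<le> B * (R * R)" using R(1) R(2)[OF z] B by (intro mult_left_mono) auto
    finally show "\<bar>P z \<bullet> Q z\<bar> \<le> C" using C by linarith
    show "bounded_linear (\<lambda>d. P d \<bullet> Q z + P z \<bullet> Q d)"
      by (intro bounded_linear_add bounded_linear_inner_left_comp bounded_linear_inner_right_comp P Q)

  qed (use C B in linarith)
qed

text \<open>The remainder is nonnegative by Cauchy-Schwarz (convexity of the norm). Its upper bound
  is the expanded inequality \<open>0 \<le> (norm (P w) - norm (P z))\<^sup>2\<close>, divided by
  \<open>2 * norm (P z)\<close>; here the distance \<open>c\<close> from zero enters the
  constant.\<close>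

lemma c11_on_norm:
  fixes P :: "'z::real_normed_vector \<Rightarrow> 'a::real_inner"
  assumes P: "bounded_linear P" and S: "bounded S" and c: "0 < c" "\<And>z. z \<in> S \<Longrightarrow> c \<le> norm (P z)"
  shows "c11_on S (\<lambda>z. norm (P z))"
proof -
  obtain B where B: "0 \<le> B" "\<And>x. norm (P x) \<le> B * norm x"
    using bounded_linear.nonneg_bounded[OF P] by (auto simp: mult.commute)
  obtain R where R: "0 < R" "\<And>x. x \<in> S \<Longrightarrow> norm x \<le> R" using S unfolding bounded_pos by blast
  define C where "C = B * R + B + B\<^sup>2 / c"
  have C: "B * R \<le> C" "B \<le> C" "B\<^sup>2 / c \<le> C" using B R c by (auto simp: C_def)
  show ?thesis
  proof (rule c11_onI[of C S "\<lambda>z d. (P z \<bullet> P d) / norm (P z)"])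
    fix z w assume zw: "z \<in> S" "w \<in> S"
    let ?d = "norm (w - z)"
    have Pw: "P (w - z) = P w - P z" using P by (simp add: linear_diff bounded_linear.linear)
    have n: "0 < norm (P z)" using c(1) c(2)[OF zw(1)] by linarith
    have Pd: "norm (P (w - z)) \<le> B * ?d" by (rule B)
    have BC: "B * ?d \<le> C * ?d" by (intro mult_right_mono C) simp
    show "\<bar>norm (P w) - norm (P z)\<bar> \<le> C * ?d"
      using norm_triangle_ineq3[of "P w" "P z"] Pd BC unfolding Pw by linarith
    have "\<bar>P z \<bullet> P (w - z) / norm (P z)\<bar> \<le> norm (P (w - z))"
      using n Cauchy_Schwarz_ineq2[of "P z" "P (w - z)"] by (simp add: field_simps abs_div)
    then show "\<bar>P z \<bullet> P (w - z) / norm (P z)\<bar> \<le> C * ?d" using Pd BC by linarith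
    have lower: "0 \<le> norm (P w) - norm (P z) - P z \<bullet> P (w - z) / norm (P z)"
    proof -
      have "P z \<bullet> P (w - z) \<le> norm (P z) * norm (P w) - norm (P z) * norm (P z)"
        using norm_cauchy_schwarz[of "P z" "P w"]
        by (simp add: Pw inner_diff_right power2_norm_eq_inner[symmetric] power2_eq_square)
      then show ?thesis using n by (simp add: field_simps)
    qed
    have "2 * norm (P z) * (norm (P w) - norm (P z)) - 2 * (P z \<bullet> P (w - z)) \<le> (norm (P (w - z)))\<^sup>2"
    proof -
      have "0 \<le> (norm (P w) - norm (P z))\<^sup>2" by simp
      moreover have "(norm (P (w - z)))\<^sup>2 = (norm (P w))\<^sup>2 - 2 * (P z \<bullet> P w) + (norm (P z))\<^sup>2"
        unfolding Pw power2_norm_eq_inner by (simp add: inner_diff inner_commute)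
      ultimately show ?thesis unfolding Pw
        by (simp add: inner_diff_right power2_norm_eq_inner[symmetric] power2_eq_square algebra_simps)
    qed
    then have "(2 * norm (P z) * (norm (P w) - norm (P z)) - 2 * (P z \<bullet> P (w - z))) / (2 * norm (P z))
         \<le> (norm (P (w - z)))\<^sup>2 / (2 * norm (P z))"
      using n by (intro divide_right_mono) auto
    moreover have "(2 * norm (P z) * (norm (P w) - norm (P z)) - 2 * (P z \<bullet> P (w - z))) / (2 * norm (P z))
       = norm (P w) - norm (P z) - P z \<bullet> P (w - z) / norm (P z)"
      using n by (simp add: diff_divide_distrib)
    ultimately have "norm (P w) - norm (P z) - P z \<bullet> P (w - z) / norm (P z)
         \<le> (norm (P (w - z)))\<^sup>2 / (2 * norm (P z))" by simp
    also have "\<dots> \<le> (B * ?d)\<^sup>2 / c"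
      using c(1) c(2)[OF zw(1)] Pd by (intro frac_le power_mono) auto
    also have "\<dots> = B\<^sup>2 / c * ?d\<^sup>2" by (simp add: power_mult_distrib)
    also have "\<dots> \<le> C * ?d\<^sup>2" by (intro mult_right_mono C) simp
    finally show "\<bar>norm (P w) - norm (P z) - P z \<bullet> P (w - z) / norm (P z)\<bar> \<le> C * ?d\<^sup>2"
      using lower by linarith
  next
    fix z assume z: "z \<in> S"
    have "norm (P z) \<le> B * norm z" by (rule B)
    also have "\<dots> \<le> B * R" using R(2)[OF z] B by (intro mult_left_mono) auto
    finally show "\<bar>norm (P z)\<bar> \<le> C" using C by simp
    show "bounded_linear (\<lambda>d. (P z \<bullet> P d) / norm (P z))"
      unfolding divide_inverse
      by (intro bounded_linear_mult_const bounded_linear_inner_right_comp P)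
  qed (use C B in linarith)
qed

lemma c11_on_continuous:
  assumes "c11_on S K" "continuous_on T z" "z ` T \<subseteq> S"
  shows "continuous_on T (\<lambda>x. K (z x))"
proof -
  obtain C K' where "c11_bound S C K K'" using assms(1) unfolding c11_on_def by blast
  note C = c11_boundD[OF this]
  have "C-lipschitz_on S K" using C(1,4) by (intro lipschitz_onI) (auto simp: dist_norm)
  then show ?thesis
    using continuous_on_compose2[OF lipschitz_on_continuous_on assms(2,3)] by blast
qed

section \<open>Means of a path\<close>

definition avg :: "real \<Rightarrow> real \<Rightarrow> (real \<Rightarrow> 'a::euclidean_space) \<Rightarrow> 'a" where
  "avg a b z = integral {a..b} z /\<^sub>R (b - a)"

lemma norm_diff_avg_le:
  fixes z :: "real \<Rightarrow> 'a::euclidean_space"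
  assumes "a < b" "continuous_on {a..b} z" "\<And>x. x \<in> {a..b} \<Longrightarrow> norm (u - z x) \<le> \<omega>"
  shows "norm (u - avg a b z) \<le> \<omega>"
proof -
  have int: "z integrable_on {a..b}" by (intro integrable_continuous_real assms)
  have "norm (integral {a..b} (\<lambda>x. u - z x)) \<le> \<omega> * (b - a)"
    using assms by (intro integral_bound) (auto intro!: continuous_intros)
  also have "integral {a..b} (\<lambda>x. u - z x) = (b - a) *\<^sub>R (u - avg a b z)"
    using assms(1) int by (subst Henstock_Kurzweil_Integration.integral_diff)
       (auto simp: avg_def scaleR_diff_right)
  finally show ?thesis using assms(1) by (simp add: mult.commute)
qed

text \<open>The mean has to lie in \<open>S\<close> by assumption: \<open>S\<close> is not convex,
  and velocities of norm at least \<open>c\<close> can have a small mean. \<open>C\<close> comes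
  from \<open>K\<close> alone, so it serves all intervals and paths.\<close>

lemma avg_c11_bound:
  assumes "c11_on S K"
  obtains C where "0 \<le> C" "\<And>a b z \<omega>. \<lbrakk>a < b; continuous_on {a..b} z; z ` {a..b} \<subseteq> S;
     avg a b z \<in> S; \<And>x y. x \<in> {a..b} \<Longrightarrow> y \<in> {a..b} \<Longrightarrow> norm (z x - z y) \<le> \<omega>\<rbrakk>
     \<Longrightarrow> \<bar>avg a b (\<lambda>x. K (z x)) - K (avg a b z)\<bar> \<le> C * \<omega>\<^sup>2"
proof -
  obtain C K' where "c11_bound S C K K'" using assms unfolding c11_on_def by blast
  note C = c11_boundD[OF this]
  show ?thesis
  proof (rule that[OF C(1)])
    fix a b and z :: "real \<Rightarrow> 'a" and \<omega> :: real
    assume ab: "a < b" and z: "continuous_on {a..b} z" "z ` {a..b} \<subseteq> S" and m: "avg a b z \<in> S"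
      and osc: "\<And>x y. x \<in> {a..b} \<Longrightarrow> y \<in> {a..b} \<Longrightarrow> norm (z x - z y) \<le> \<omega>"
    define m where "m = avg a b z"
    have bl: "bounded_linear (K' m)" using C(2) m by (simp add: m_def)
    have contK: "continuous_on {a..b} (\<lambda>x. K (z x))" by (rule c11_on_continuous[OF assms z])
    have cont: "continuous_on {a..b} (\<lambda>x. K' m (z x - m))"
      by (intro bounded_linear.continuous_on[OF bl] continuous_intros z)
    have near: "norm (z x - m) \<le> \<omega>" if "x \<in> {a..b}" for x
      unfolding m_def by (intro norm_diff_avg_le ab z osc that)
    have zero: "integral {a..b} (\<lambda>x. K' m (z x - m)) = 0"
    proof -
      have "integral {a..b} (\<lambda>x. K' m (z x - m)) = K' m (integral {a..b} (\<lambda>x. z x - m))"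
        using integral_linear[OF _ bl, of "\<lambda>x. z x - m" "{a..b}"]
        by (simp add: o_def integrable_continuous_real continuous_intros z)
      also have "integral {a..b} (\<lambda>x. z x - m) = 0"
        using ab by (subst Henstock_Kurzweil_Integration.integral_diff)
          (auto simp: m_def avg_def integrable_continuous_real z)
      finally show ?thesis using bl by (simp add: linear_0 bounded_linear.linear)
    qed
    have "norm (integral {a..b} (\<lambda>x. K (z x) - K m - K' m (z x - m))) \<le> C * \<omega>\<^sup>2 * (b - a)"
    proof (intro integral_bound)
      fix x assume x: "x \<in> {a..b}"
      have "norm (K (z x) - K m - K' m (z x - m)) \<le> C * (norm (z x - m))\<^sup>2"
        using C(6)[of m "z x"] m z(2) x by (auto simp: m_def image_subset_iff)
      also have "\<dots> \<le> C * \<omega>\<^sup>2" by (intro mult_left_mono power_mono near x C) simp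
      finally show "norm (K (z x) - K m - K' m (z x - m)) \<le> C * \<omega>\<^sup>2" .
    qed (use ab in \<open>auto intro!: continuous_intros contK cont\<close>)
    also have "integral {a..b} (\<lambda>x. K (z x) - K m - K' m (z x - m))
        = (b - a) * (avg a b (\<lambda>x. K (z x)) - K m)"
      using ab zero
      by (simp add: Henstock_Kurzweil_Integration.integral_diff integrable_continuous_real
          continuous_intros contK cont avg_def right_diff_distrib)
    finally show "\<bar>avg a b (\<lambda>x. K (z x)) - K (avg a b z)\<bar> \<le> C * \<omega>\<^sup>2"
      using ab by (simp add: abs_mult m_def mult.commute)
  qed
qed

section \<open>The norm and its first two variations\<close>

definition norm_d1 :: "'a::real_inner \<Rightarrow> 'a \<Rightarrow> real" where
  "norm_d1 v y = (v \<bullet> y) / norm v"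

text \<open>The Hessian of the norm at \<open>v\<close>, as a bilinear form in \<open>y\<close> and
  \<open>z\<close>.\<close>

definition norm_d2 :: "'a::real_inner \<Rightarrow> 'a \<Rightarrow> 'a \<Rightarrow> real" where
  "norm_d2 v y z = (y \<bullet> z) / norm v - (v \<bullet> y) * (v \<bullet> z) / norm v ^ 3"

lemma has_real_derivative_norm_line:
  fixes v y :: "'a::real_inner"
  assumes "v + e *\<^sub>R y \<noteq> 0"
  shows "((\<lambda>\<epsilon>. norm (v + \<epsilon> *\<^sub>R y)) has_real_derivative norm_d1 (v + e *\<^sub>R y) y) (at e)"
proof -
  have "((\<lambda>\<epsilon>. sqrt ((v + \<epsilon> *\<^sub>R y) \<bullet> (v + \<epsilon> *\<^sub>R y))) has_real_derivative norm_d1 (v + e *\<^sub>R y) y) (at e)"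
    unfolding has_field_derivative_def
    by (rule derivative_eq_intros refl | use assms in force)+
      (use assms in \<open>auto simp: fun_eq_iff norm_d1_def norm_eq_sqrt_inner[symmetric] inner_commute field_simps\<close>)
  then show ?thesis by (simp add: norm_eq_sqrt_inner)
qed

lemma has_real_derivative_norm_d1_line:
  fixes v y z :: "'a::real_inner"
  assumes "v + e *\<^sub>R z \<noteq> 0"
  shows "((\<lambda>\<epsilon>. norm_d1 (v + \<epsilon> *\<^sub>R z) y) has_real_derivative norm_d2 (v + e *\<^sub>R z) y z) (at e)"
proof -
  have i: "((\<lambda>\<epsilon>. (v + \<epsilon> *\<^sub>R z) \<bullet> y) has_real_derivative z \<bullet> y) (at e)"
    unfolding inner_add_left inner_scaleR_left by (auto intro!: derivative_eq_intros)
  have n: "norm (v + e *\<^sub>R z) \<noteq> 0" using assms by simp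
  show ?thesis
    unfolding norm_d1_def norm_d2_def
    by (rule DERIV_cong[OF DERIV_divide[OF i has_real_derivative_norm_line[OF assms] n]])
      (use n in \<open>simp add: norm_d1_def inner_commute field_simps power3_eq_cube\<close>)
qed

lemma norm_d1_bound: "v \<noteq> 0 \<Longrightarrow> \<bar>norm_d1 v y\<bar> \<le> norm y"
  using Cauchy_Schwarz_ineq2[of v y] by (simp add: norm_d1_def abs_divide field_simps)

lemma norm_d2_bound:
  assumes "v \<noteq> 0"
  shows "\<bar>norm_d2 v y z\<bar> \<le> 2 * norm y * norm z / norm v"
proof -
  have n: "0 < norm v" using assms by simp
  have "norm_d2 v y z = ((y \<bullet> z) - norm_d1 v y * norm_d1 v z) / norm v"
    using n by (simp add: norm_d1_def norm_d2_def field_simps power3_eq_cube)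
  also have "\<bar>\<dots>\<bar> \<le> (norm y * norm z + norm y * norm z) / norm v"
    unfolding abs_divide abs_norm_cancel
    by (intro divide_right_mono order_trans[OF abs_triangle_ineq4] add_mono Cauchy_Schwarz_ineq2)
      (auto simp: abs_mult intro!: mult_mono norm_d1_bound assms)
  finally show ?thesis by simp
qed

text \<open>The norm is homogeneous of degree one, so scaling the point and all directions together
  multiplies each variation by \<open>k\<close>. With the length of the interval for
  \<open>k\<close>, this passes between integrals and means.\<close>

lemma norm_d1_scale: "0 < k \<Longrightarrow> norm_d1 (k *\<^sub>R v) (k *\<^sub>R y) = k * norm_d1 v y"
  by (simp add: norm_d1_def)

lemma norm_d2_scale: "0 < k \<Longrightarrow> norm_d2 (k *\<^sub>R v) (k *\<^sub>R y) (k *\<^sub>R z) = k * norm_d2 v y z"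
  by (cases "v = 0") (auto simp: norm_d2_def field_simps power3_eq_cube)

lemma continuous_on_norm_d1:
  assumes "continuous_on T v" "continuous_on T y" "\<And>x. x \<in> T \<Longrightarrow> v x \<noteq> 0"
  shows "continuous_on T (\<lambda>x. norm_d1 (v x) (y x))"
  unfolding norm_d1_def by (intro continuous_intros assms) (use assms in auto)

lemma continuous_on_norm_d2:
  assumes "continuous_on T v" "continuous_on T y" "continuous_on T z" "\<And>x. x \<in> T \<Longrightarrow> v x \<noteq> 0"
  shows "continuous_on T (\<lambda>x. norm_d2 (v x) (y x) (z x))"
  unfolding norm_d2_def by (intro continuous_intros assms) (use assms in auto)

text \<open>A velocity packed together with two directions of variation: the norm and its variations
  become functions of one variable, and the mean estimate applies to the path of triples.\<close>

definition triples :: "real \<Rightarrow> real \<Rightarrow> ('a::real_inner \<times> 'a \<times> 'a) set" where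
  "triples c M = {(v, y, z). c \<le> norm v \<and> norm v \<le> M \<and> norm y \<le> M \<and> norm z \<le> M}"

lemma bounded_triples: "bounded (triples c M)"
proof -
  have "triples c M \<subseteq> cball 0 M \<times> cball 0 M \<times> cball 0 M" by (auto simp: triples_def)
  then show ?thesis using bounded_subset bounded_Times bounded_cball by metis
qed

lemma c11_on_norm_derivs:
  assumes "0 < c"
  shows "c11_on (triples c M) (\<lambda>(v, y, z). norm (v::'a::real_inner))"
    "c11_on (triples c M) (\<lambda>(v, y, z). norm_d1 (v::'a) y)"
    "c11_on (triples c M) (\<lambda>(v, y, z). norm_d2 (v::'a) y z)"
proof -
  let ?S = "triples c M :: ('a \<times> 'a \<times> 'a) set"
  have bl: "bounded_linear (\<lambda>t::'a \<times> 'a \<times> 'a. fst t)" "bounded_linear (\<lambda>t::'a \<times> 'a \<times> 'a. fst (snd t))"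
    "bounded_linear (\<lambda>t::'a \<times> 'a \<times> 'a. snd (snd t))"
    by (intro bounded_linear_fst bounded_linear_fst_comp bounded_linear_snd_comp bounded_linear_snd bounded_linear_ident)+
  have low: "c \<le> norm (fst t)" if "t \<in> ?S" for t using that by (auto simp: triples_def)
  note N = c11_on_norm[OF bl(1) bounded_triples[of c M] assms low]
  note J = c11_on_inverse[OF N assms low]
  note I = c11_on_inner[OF _ _ bounded_triples[of c M]]
  show "c11_on ?S (\<lambda>(v, y, z). norm v)" using N by (simp add: case_prod_unfold)
  show "c11_on ?S (\<lambda>(v, y, z). norm_d1 v y)"
    using c11_on_mult[OF I[OF bl(1) bl(2)] J] by (simp add: case_prod_unfold norm_d1_def divide_inverse)
  have "c11_on ?S (\<lambda>t. (fst (snd t) \<bullet> snd (snd t)) * inverse (norm (fst t)) -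
      ((fst t \<bullet> fst (snd t)) * (fst t \<bullet> snd (snd t))) *
      (inverse (norm (fst t)) * (inverse (norm (fst t)) * inverse (norm (fst t)))))"
    by (intro c11_on_diff c11_on_mult I J bl)
  then show "c11_on ?S (\<lambda>(v, y, z). norm_d2 v y z)"
    by (simp add: case_prod_unfold norm_d2_def divide_inverse power3_eq_cube mult.assoc)
qed

lemma avg_Pair:
  fixes u :: "real \<Rightarrow> 'a::euclidean_space" and w :: "real \<Rightarrow> 'b::euclidean_space"
  assumes "continuous_on {a..b} u" "continuous_on {a..b} w"
  shows "avg a b (\<lambda>x. (u x, w x)) = (avg a b u, avg a b w)"
proof -
  have int: "(\<lambda>x. (u x, w x)) integrable_on {a..b}"
    by (intro integrable_continuous_real continuous_intros assms)
  have "fst (integral {a..b} (\<lambda>x. (u x, w x))) = integral {a..b} u"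
    "snd (integral {a..b} (\<lambda>x. (u x, w x))) = integral {a..b} w"
    using integral_linear[OF int bounded_linear_fst] integral_linear[OF int bounded_linear_snd]
    by (simp_all add: o_def)
  then show ?thesis by (intro prod_eqI) (simp_all add: avg_def)
qed

text \<open>All that the estimates use about one arc: \<open>v\<close> is the velocity of the curve,
  \<open>y\<close> and \<open>z\<close> those of the variations, \<open>\<omega>\<close> bounds the
  oscillation. The lower bound on the mean does not follow from the pointwise one; it is the form in
  which bi-Lipschitz continuity is used.\<close>

definition tame :: "real \<Rightarrow> real \<Rightarrow> real \<Rightarrow> real \<Rightarrow> real \<Rightarrow>
    (real \<Rightarrow> 'a::euclidean_space) \<Rightarrow> (real \<Rightarrow> 'a) \<Rightarrow> (real \<Rightarrow> 'a) \<Rightarrow> bool" where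
  "tame c M \<omega> a b v y z \<longleftrightarrow> a < b \<and>
     continuous_on {a..b} v \<and> continuous_on {a..b} y \<and> continuous_on {a..b} z \<and>
     (\<forall>x\<in>{a..b}. (v x, y x, z x) \<in> triples c M) \<and> c \<le> norm (avg a b v) \<and>
     (\<forall>x\<in>{a..b}. \<forall>x'\<in>{a..b}. norm (v x - v x') \<le> \<omega> \<and>
        norm (y x - y x') \<le> \<omega> \<and> norm (z x - z x') \<le> \<omega>)"

lemma tameD:
  assumes "tame c M \<omega> a b v y z"
  shows "a < b" "continuous_on {a..b} v" "continuous_on {a..b} y" "continuous_on {a..b} z"
    "\<And>x. x \<in> {a..b} \<Longrightarrow> (v x, y x, z x) \<in> triples c M" "c \<le> norm (avg a b v)"
    "\<And>x x'. x \<in> {a..b} \<Longrightarrow> x' \<in> {a..b} \<Longrightarrow> norm (v x - v x') \<le> \<omega>"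
    "\<And>x x'. x \<in> {a..b} \<Longrightarrow> x' \<in> {a..b} \<Longrightarrow> norm (y x - y x') \<le> \<omega>"
    "\<And>x x'. x \<in> {a..b} \<Longrightarrow> x' \<in> {a..b} \<Longrightarrow> norm (z x - z x') \<le> \<omega>"
  using assms unfolding tame_def by blast+

lemma tame_swap: "tame c M \<omega> a b v y z \<Longrightarrow> tame c M \<omega> a b v z y"
  unfolding tame_def triples_def by auto

lemma tame_same: "tame c M \<omega> a b v y z \<Longrightarrow> tame c M \<omega> a b v y y"
  unfolding tame_def triples_def by auto

lemma norm_avg_le:
  fixes w :: "real \<Rightarrow> 'a::euclidean_space"
  assumes "a < b" "continuous_on {a..b} w" "\<And>x. x \<in> {a..b} \<Longrightarrow> norm (w x) \<le> B"
  shows "norm (avg a b w) \<le> B"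
  using norm_diff_avg_le[of a b w 0 B] assms by simp

lemma avg_norm_derivs_bound:
  fixes c M :: real
  assumes "0 < c"
  obtains C where "0 \<le> C"
    "\<And>a b \<omega> (v :: real \<Rightarrow> 'a::euclidean_space) y z. tame c M \<omega> a b v y z \<Longrightarrow>
       \<bar>avg a b (\<lambda>x. norm (v x)) - norm (avg a b v)\<bar> \<le> C * \<omega>\<^sup>2 \<and>
       \<bar>avg a b (\<lambda>x. norm_d1 (v x) (y x)) - norm_d1 (avg a b v) (avg a b y)\<bar> \<le> C * \<omega>\<^sup>2 \<and>
       \<bar>avg a b (\<lambda>x. norm_d2 (v x) (y x) (z x)) - norm_d2 (avg a b v) (avg a b y) (avg a b z)\<bar> \<le> C * \<omega>\<^sup>2"
proof -
  note c11 = c11_on_norm_derivs[OF assms, of M, where 'a='a]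
  obtain C0 where C0: "0 \<le> C0" "\<And>a b z \<omega>. \<lbrakk>a < b; continuous_on {a..b} z; z ` {a..b} \<subseteq> triples c M;
     avg a b z \<in> triples c M; \<And>x y. x \<in> {a..b} \<Longrightarrow> y \<in> {a..b} \<Longrightarrow> norm (z x - z y) \<le> \<omega>\<rbrakk>
     \<Longrightarrow> \<bar>avg a b (\<lambda>x. (\<lambda>(v::'a, y, z). norm v) (z x)) - (\<lambda>(v::'a, y, z). norm v) (avg a b z)\<bar> \<le> C0 * \<omega>\<^sup>2"
    using avg_c11_bound[OF c11(1)] by blast
  obtain C1 where C1: "0 \<le> C1" "\<And>a b z \<omega>. \<lbrakk>a < b; continuous_on {a..b} z; z ` {a..b} \<subseteq> triples c M;
     avg a b z \<in> triples c M; \<And>x y. x \<in> {a..b} \<Longrightarrow> y \<in> {a..b} \<Longrightarrow> norm (z x - z y) \<le> \<omega>\<rbrakk>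
     \<Longrightarrow> \<bar>avg a b (\<lambda>x. (\<lambda>(v::'a, y, z). norm_d1 v y) (z x)) - (\<lambda>(v::'a, y, z). norm_d1 v y) (avg a b z)\<bar> \<le> C1 * \<omega>\<^sup>2"
    using avg_c11_bound[OF c11(2)] by blast
  obtain C2 where C2: "0 \<le> C2" "\<And>a b z \<omega>. \<lbrakk>a < b; continuous_on {a..b} z; z ` {a..b} \<subseteq> triples c M;
     avg a b z \<in> triples c M; \<And>x y. x \<in> {a..b} \<Longrightarrow> y \<in> {a..b} \<Longrightarrow> norm (z x - z y) \<le> \<omega>\<rbrakk>
     \<Longrightarrow> \<bar>avg a b (\<lambda>x. (\<lambda>(v::'a, y, z). norm_d2 v y z) (z x)) - (\<lambda>(v::'a, y, z). norm_d2 v y z) (avg a b z)\<bar> \<le> C2 * \<omega>\<^sup>2"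
    using avg_c11_bound[OF c11(3)] by blast
  show ?thesis
  \<comment> \<open>The factor 9 is the square of 3: the path of triples oscillates by at most
    \<open>3 * \<omega>\<close>, one \<open>\<omega>\<close> per component.\<close>
  proof (rule that[of "9 * (C0 + C1 + C2)"])
    show "0 \<le> 9 * (C0 + C1 + C2)" using C0 C1 C2 by simp
    fix a b \<omega> and v y z :: "real \<Rightarrow> 'a"
    assume "tame c M \<omega> a b v y z"
    note T = tameD[OF this]
    note ab = T(1) and cont = T(2-4) and S = T(5) and low = T(6) and osc = T(7-9)
    let ?t = "\<lambda>x. (v x, y x, z x)"
    have ct: "continuous_on {a..b} ?t" by (intro continuous_intros cont)
    have at: "avg a b ?t = (avg a b v, avg a b y, avg a b z)"
      by (simp add: avg_Pair cont continuous_intros)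
    have atS: "avg a b ?t \<in> triples c M"
      using S low cont unfolding at by (auto simp: triples_def intro!: norm_avg_le ab)
    have osct: "norm (?t x - ?t x') \<le> 3 * \<omega>" if "x \<in> {a..b}" "x' \<in> {a..b}" for x x'
    proof -
      have "norm (?t x - ?t x') \<le> norm (v x - v x') + (norm (y x - y x') + norm (z x - z x'))"
        using norm_Pair_le[of "v x - v x'" "(y x - y x', z x - z x')"]
          norm_Pair_le[of "y x - y x'" "z x - z x'"] by simp
      then show ?thesis using osc[OF that] by linarith
    qed
    have img: "?t ` {a..b} \<subseteq> triples c M" using S by blast
    have sq: "C * (3 * \<omega>)\<^sup>2 \<le> 9 * (C0 + C1 + C2) * \<omega>\<^sup>2" if "C \<le> C0 + C1 + C2" for C
      using mult_right_mono[OF that, of "9 * \<omega>\<^sup>2"] by (simp add: power_mult_distrib algebra_simps)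
    have C: "C0 \<le> C0 + C1 + C2" "C1 \<le> C0 + C1 + C2" "C2 \<le> C0 + C1 + C2" using C0(1) C1(1) C2(1) by auto
    show "\<bar>avg a b (\<lambda>x. norm (v x)) - norm (avg a b v)\<bar> \<le> 9 * (C0 + C1 + C2) * \<omega>\<^sup>2 \<and>
       \<bar>avg a b (\<lambda>x. norm_d1 (v x) (y x)) - norm_d1 (avg a b v) (avg a b y)\<bar> \<le> 9 * (C0 + C1 + C2) * \<omega>\<^sup>2 \<and>
       \<bar>avg a b (\<lambda>x. norm_d2 (v x) (y x) (z x)) - norm_d2 (avg a b v) (avg a b y) (avg a b z)\<bar> \<le> 9 * (C0 + C1 + C2) * \<omega>\<^sup>2"
      using C0(2)[OF ab ct img atS osct] C1(2)[OF ab ct img atS osct] C2(2)[OF ab ct img atS osct]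
        sq[OF C(1)] sq[OF C(2)] sq[OF C(3)]
      unfolding at by simp
  qed
qed

section \<open>Powers with exponent -\<alpha> of a varying base\<close>

definition powr_d1 :: "real \<Rightarrow> real \<Rightarrow> real \<Rightarrow> real" where
  "powr_d1 \<alpha> x y = - \<alpha> * x powr (- \<alpha> - 1) * y"

text \<open>Chain rule for a base \<open>x\<close> that itself depends on two parameters:
  \<open>y\<close> and \<open>z\<close> stand for its first variations and \<open>w\<close> for its
  mixed second variation.\<close>

definition powr_d2 :: "real \<Rightarrow> real \<Rightarrow> real \<Rightarrow> real \<Rightarrow> real \<Rightarrow> real" where
  "powr_d2 \<alpha> x y z w = \<alpha> * (\<alpha> + 1) * x powr (- \<alpha> - 2) * y * z - \<alpha> * x powr (- \<alpha> - 1) * w"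

text \<open>Pulling the interval length \<open>k\<close> out of chord and arc leaves the factor
  \<open>k powr - \<alpha>\<close>, which the closeness of the two means has to compensate.\<close>

lemma powr_d1_scale:
  "0 < k \<Longrightarrow> 0 < x \<Longrightarrow> powr_d1 \<alpha> (k * x) (k * y) = k powr - \<alpha> * powr_d1 \<alpha> x y"
  by (simp add: powr_d1_def powr_mult powr_diff)

lemma powr_d2_scale:
  assumes "0 < k" "0 < x"
  shows "powr_d2 \<alpha> (k * x) (k * y) (k * z) (k * w) = k powr - \<alpha> * powr_d2 \<alpha> x y z w"
proof -
  have "(k * x) powr (- \<alpha> - 2) * (k * k) = k powr - \<alpha> * x powr (- \<alpha> - 2)"
    "(k * x) powr (- \<alpha> - 1) * k = k powr - \<alpha> * x powr (- \<alpha> - 1)"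
    using assms by (simp_all add: powr_mult powr_diff power2_eq_square)
  then show ?thesis unfolding powr_d2_def by algebra
qed

lemma has_real_derivative_powr_comp:
  assumes "(g has_real_derivative g') (at e)" "0 < g e"
  shows "((\<lambda>\<epsilon>. g \<epsilon> powr - \<alpha>) has_real_derivative powr_d1 \<alpha> (g e) g') (at e)"
  by (rule DERIV_cong[OF DERIV_fun_powr[OF assms(1,2)]]) (simp add: powr_d1_def)

lemma has_real_derivative_powr_d1_comp:
  assumes "(g has_real_derivative g') (at e)" "0 < g e" "(h has_real_derivative h') (at e)"
  shows "((\<lambda>\<epsilon>. powr_d1 \<alpha> (g \<epsilon>) (h \<epsilon>)) has_real_derivative powr_d2 \<alpha> (g e) (h e) g' h') (at e)"
  unfolding powr_d1_def
  by (rule DERIV_cong[OF DERIV_mult[OF DERIV_mult[OF DERIV_const DERIV_fun_powr[OF assms(1,2)]] assms(3)]])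
    (simp add: powr_d2_def algebra_simps)

text \<open>A power is monotone, increasing or decreasing according to the sign of \<open>q\<close>;
  the sum of the end values covers both cases.\<close>

lemma powr_bound_interval:
  fixes c M q :: real
  assumes "0 < c" "c \<le> x" "x \<le> M"
  shows "x powr q \<le> c powr q + M powr q"
proof (cases "0 \<le> q")
  case True
  then show ?thesis using powr_mono2[of q x M] assms by (simp add: add_increasing)
next
  case False
  then show ?thesis using powr_mono2'[of q c x] assms by (simp add: add_increasing2)
qed

lemma powr_lipschitz_interval:
  fixes c M q :: real
  assumes "0 < c" "c \<le> x" "x \<le> M" "c \<le> x'" "x' \<le> M"
  shows "\<bar>x powr q - x' powr q\<bar> \<le> \<bar>q\<bar> * (c powr (q - 1) + M powr (q - 1)) * \<bar>x - x'\<bar>"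
proof -
  have "norm (x powr q - x' powr q) \<le> \<bar>q\<bar> * (c powr (q - 1) + M powr (q - 1)) * norm (x - x')"
  proof (rule field_differentiable_bound[of "{c..M}"])
    fix t assume t: "t \<in> {c..M}"
    show "((\<lambda>t. t powr q) has_field_derivative q * t powr (q - 1)) (at t within {c..M})"
      using t assms(1) by (auto intro!: derivative_eq_intros)
    show "norm (q * t powr (q - 1)) \<le> \<bar>q\<bar> * (c powr (q - 1) + M powr (q - 1))"
      using powr_bound_interval[OF assms(1), of t M "q - 1"] t by (simp add: abs_mult mult_left_mono)
  qed (use assms in auto)
  then show ?thesis by simp
qed

lemma abs_mult_diff_le:
  fixes x x' y y' :: real
  assumes "\<bar>x'\<bar> \<le> A" "\<bar>y\<bar> \<le> B" "\<bar>x - x'\<bar> \<le> D * \<delta>" "\<bar>y - y'\<bar> \<le> E * \<delta>"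
  shows "\<bar>x * y - x' * y'\<bar> \<le> (D * B + A * E) * \<delta>"
proof -
  have "x * y - x' * y' = (x - x') * y + x' * (y - y')" by algebra
  also have "\<bar>\<dots>\<bar> \<le> (D * \<delta>) * B + A * (E * \<delta>)"
    by (intro order_trans[OF abs_triangle_ineq] add_mono; unfold abs_mult)
      (intro mult_mono assms; use assms in linarith)+
  finally show ?thesis by (simp add: algebra_simps)
qed

lemma powr_derivs_lipschitz:
  fixes c M \<alpha> :: real
  assumes c: "0 < c"
  obtains C where "0 \<le> C"
    "\<And>x x' y y' z z' w w' \<delta>. \<lbrakk>c \<le> x; x \<le> M; c \<le> x'; x' \<le> M; \<bar>y\<bar> \<le> M; \<bar>y'\<bar> \<le> M; \<bar>z\<bar> \<le> M; \<bar>z'\<bar> \<le> M;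
      \<bar>w\<bar> \<le> M; \<bar>w'\<bar> \<le> M; \<bar>x - x'\<bar> \<le> \<delta>; \<bar>y - y'\<bar> \<le> \<delta>; \<bar>z - z'\<bar> \<le> \<delta>; \<bar>w - w'\<bar> \<le> \<delta>\<rbrakk> \<Longrightarrow>
      \<bar>x powr - \<alpha> - x' powr - \<alpha>\<bar> \<le> C * \<delta> \<and>
      \<bar>powr_d1 \<alpha> x y - powr_d1 \<alpha> x' y'\<bar> \<le> C * \<delta> \<and>
      \<bar>powr_d2 \<alpha> x y z w - powr_d2 \<alpha> x' y' z' w'\<bar> \<le> C * \<delta>"
proof -
  define B where "B q = c powr q + M powr q" for q
  define D where "D q = \<bar>q\<bar> * B (q - 1)" for q
  have B0: "0 \<le> B q" and D0: "0 \<le> D q" for q by (auto simp: B_def D_def)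
  define E where "E q = D q * M + B q * 1" for q
  define F where "F = D (- \<alpha> - 2) * (M * M) + B (- \<alpha> - 2) * (1 * M + M * 1)"
  \<comment> \<open>\<open>0 \<le> C\<close> must hold before any \<open>x\<close> in
    \<open>{c..M}\<close> is given, so nothing is known about the sign of \<open>M\<close>; hence
    the absolute values of \<open>E\<close> and \<open>F\<close>.\<close>
  define C where "C = D (- \<alpha>) + \<bar>\<alpha>\<bar> * \<bar>E (- \<alpha> - 1)\<bar> + \<bar>\<alpha> * (\<alpha> + 1)\<bar> * \<bar>F\<bar>"
  have C: "0 \<le> C" "D (- \<alpha>) \<le> C" "\<bar>\<alpha>\<bar> * \<bar>E (- \<alpha> - 1)\<bar> \<le> C"
    "\<bar>\<alpha> * (\<alpha> + 1)\<bar> * \<bar>F\<bar> + \<bar>\<alpha>\<bar> * \<bar>E (- \<alpha> - 1)\<bar> \<le> C"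
    using D0 by (auto simp: C_def)
  show ?thesis
  proof (rule that[OF C(1)])
    fix x x' y y' z z' w w' \<delta> :: real
    assume x: "c \<le> x" "x \<le> M" "c \<le> x'" "x' \<le> M" and y: "\<bar>y\<bar> \<le> M" "\<bar>y'\<bar> \<le> M" and z: "\<bar>z\<bar> \<le> M" "\<bar>z'\<bar> \<le> M"
      and w: "\<bar>w\<bar> \<le> M" "\<bar>w'\<bar> \<le> M"
      and d: "\<bar>x - x'\<bar> \<le> \<delta>" "\<bar>y - y'\<bar> \<le> \<delta>" "\<bar>z - z'\<bar> \<le> \<delta>" "\<bar>w - w'\<bar> \<le> \<delta>"
    have d0: "0 \<le> \<delta>" using d by linarith
    have P: "\<bar>x powr q - x' powr q\<bar> \<le> D q * \<delta>" for q
    proof -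
      have "\<bar>x powr q - x' powr q\<bar> \<le> D q * \<bar>x - x'\<bar>"
        unfolding D_def B_def by (rule powr_lipschitz_interval[OF c x])
      also have "\<dots> \<le> D q * \<delta>" by (intro mult_left_mono d D0)
      finally show ?thesis .
    qed
    have b: "\<bar>x' powr q\<bar> \<le> B q" for q using powr_bound_interval[OF c x(3,4), of q] by (simp add: B_def)
    have E: "\<bar>x powr q * y - x' powr q * y'\<bar> \<le> E q * \<delta>" "\<bar>x powr q * w - x' powr q * w'\<bar> \<le> E q * \<delta>" for q
      unfolding E_def by (rule abs_mult_diff_le b P y w | use d in simp)+
    have yz: "\<bar>y * z - y' * z'\<bar> \<le> (1 * M + M * 1) * \<delta>"
      by (rule abs_mult_diff_le) (use y z d in auto)
    have yzb: "\<bar>y * z\<bar> \<le> M * M" unfolding abs_mult using y z by (intro mult_mono) auto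
    have F: "\<bar>x powr (- \<alpha> - 2) * (y * z) - x' powr (- \<alpha> - 2) * (y' * z')\<bar> \<le> F * \<delta>"
      unfolding F_def by (rule abs_mult_diff_le b P yzb yz)+
    have ab: "\<bar>k * s - k * t\<bar> \<le> \<bar>k\<bar> * \<bar>H\<bar> * \<delta>" if "\<bar>s - t\<bar> \<le> H * \<delta>" for k s t H :: real
    proof -
      have "H * \<delta> \<le> \<bar>H\<bar> * \<delta>" using d0 by (intro mult_right_mono) auto
      then have "\<bar>k\<bar> * \<bar>s - t\<bar> \<le> \<bar>k\<bar> * (\<bar>H\<bar> * \<delta>)" using that by (intro mult_left_mono) auto
      then show ?thesis by (simp add: abs_mult right_diff_distrib[symmetric] mult.assoc)
    qed
    have CC: "K \<le> C \<Longrightarrow> K * \<delta> \<le> C * \<delta>" for K using d0 by (simp add: mult_right_mono)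
    have 1: "\<bar>x powr - \<alpha> - x' powr - \<alpha>\<bar> \<le> C * \<delta>" using P[of "- \<alpha>"] CC[OF C(2)] by linarith
    have 2: "\<bar>powr_d1 \<alpha> x y - powr_d1 \<alpha> x' y'\<bar> \<le> C * \<delta>"
      using ab[OF E(1)[of "- \<alpha> - 1"], of "- \<alpha>"] CC[OF C(3)]
      by (simp add: powr_d1_def mult.assoc)
    have "\<bar>powr_d2 \<alpha> x y z w - powr_d2 \<alpha> x' y' z' w'\<bar>
       \<le> \<bar>\<alpha> * (\<alpha> + 1) * (x powr (- \<alpha> - 2) * (y * z)) - \<alpha> * (\<alpha> + 1) * (x' powr (- \<alpha> - 2) * (y' * z'))\<bar>
        + \<bar>\<alpha> * (x powr (- \<alpha> - 1) * w) - \<alpha> * (x' powr (- \<alpha> - 1) * w')\<bar>"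
      unfolding powr_d2_def by (simp add: mult.assoc)
    also have "\<dots> \<le> (\<bar>\<alpha> * (\<alpha> + 1)\<bar> * \<bar>F\<bar> + \<bar>\<alpha>\<bar> * \<bar>E (- \<alpha> - 1)\<bar>) * \<delta>"
      using ab[OF F, of "\<alpha> * (\<alpha> + 1)"] ab[OF E(2)[of "- \<alpha> - 1"], of "\<alpha>"] by (simp add: distrib_right)
    also have "\<dots> \<le> C * \<delta>" by (rule CC[OF C(4)])
    finally show "\<bar>x powr - \<alpha> - x' powr - \<alpha>\<bar> \<le> C * \<delta> \<and>
      \<bar>powr_d1 \<alpha> x y - powr_d1 \<alpha> x' y'\<bar> \<le> C * \<delta> \<and>
      \<bar>powr_d2 \<alpha> x y z w - powr_d2 \<alpha> x' y' z' w'\<bar> \<le> C * \<delta>" using 1 2 by blast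
  qed
qed

section \<open>Chord against arc\<close>

text \<open>
  For \<open>v = g'\<close>, \<open>defect0\<close> is the base of the energy density of \<open>g\<close> at \<open>(a, b)\<close>, provided the arc over
  \<open>[a, b]\<close> is the shorter one; \<open>defect1\<close> is its variation in the direction \<open>y\<close>, and \<open>defect2\<close> the
  variation of \<open>defect1\<close> in the direction \<open>z\<close>.
\<close>

definition defect0 :: "real \<Rightarrow> real \<Rightarrow> real \<Rightarrow> (real \<Rightarrow> 'a::euclidean_space) \<Rightarrow> real" where
  "defect0 \<alpha> a b v =
     norm (integral {a..b} v) powr - \<alpha> - (integral {a..b} (\<lambda>x. norm (v x))) powr - \<alpha>"

definition defect1 ::
  "real \<Rightarrow> real \<Rightarrow> real \<Rightarrow> (real \<Rightarrow> 'a::euclidean_space) \<Rightarrow> (real \<Rightarrow> 'a) \<Rightarrow> real" where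
  "defect1 \<alpha> a b v y =
     powr_d1 \<alpha> (norm (integral {a..b} v)) (norm_d1 (integral {a..b} v) (integral {a..b} y))
   - powr_d1 \<alpha> (integral {a..b} (\<lambda>x. norm (v x))) (integral {a..b} (\<lambda>x. norm_d1 (v x) (y x)))"

definition defect2 ::
  "real \<Rightarrow> real \<Rightarrow> real \<Rightarrow> (real \<Rightarrow> 'a::euclidean_space) \<Rightarrow> (real \<Rightarrow> 'a) \<Rightarrow> (real \<Rightarrow> 'a) \<Rightarrow> real" where
  "defect2 \<alpha> a b v y z =
     powr_d2 \<alpha> (norm (integral {a..b} v)) (norm_d1 (integral {a..b} v) (integral {a..b} y))
       (norm_d1 (integral {a..b} v) (integral {a..b} z))
       (norm_d2 (integral {a..b} v) (integral {a..b} y) (integral {a..b} z))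
   - powr_d2 \<alpha> (integral {a..b} (\<lambda>x. norm (v x))) (integral {a..b} (\<lambda>x. norm_d1 (v x) (y x)))
       (integral {a..b} (\<lambda>x. norm_d1 (v x) (z x))) (integral {a..b} (\<lambda>x. norm_d2 (v x) (y x) (z x)))"

text \<open>Compactness gives a positive minimum \<open>m\<close> of the norm and a bound
  \<open>B\<close> for \<open>z\<close>; a parameter change below \<open>m / B\<close> moves every
  value by less than \<open>m\<close>. A radius common to all \<open>x\<close> is what
  differentiation under the integral needs.\<close>

lemma nonvanishing_nearby:
  fixes v z :: "real \<Rightarrow> 'a::real_normed_vector"
  assumes "continuous_on {a..b} v" "continuous_on {a..b} z" "\<And>x. x \<in> {a..b} \<Longrightarrow> v x + e *\<^sub>R z x \<noteq> 0"
  obtains r where "0 < r" "\<And>\<epsilon> x. \<epsilon> \<in> ball e r \<Longrightarrow> x \<in> {a..b} \<Longrightarrow> v x + \<epsilon> *\<^sub>R z x \<noteq> 0"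
proof (cases "a \<le> b")
  case True
  have "bounded (z ` {a..b})" by (intro compact_imp_bounded compact_continuous_image assms) simp
  then obtain B where B: "0 < B" "\<And>x. x \<in> {a..b} \<Longrightarrow> norm (z x) \<le> B"
    unfolding bounded_pos by auto
  have "continuous_on {a..b} (\<lambda>x. norm (v x + e *\<^sub>R z x))" by (intro continuous_intros assms)
  then obtain x0 where x0: "x0 \<in> {a..b}"
    "\<And>x. x \<in> {a..b} \<Longrightarrow> norm (v x0 + e *\<^sub>R z x0) \<le> norm (v x + e *\<^sub>R z x)"
    using continuous_attains_inf[of "{a..b}" "\<lambda>x. norm (v x + e *\<^sub>R z x)"] True by auto
  define m where "m = norm (v x0 + e *\<^sub>R z x0)"
  have m: "0 < m" using assms(3)[OF x0(1)] by (simp add: m_def)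
  show ?thesis
  proof (rule that[of "m / B"])
    show "0 < m / B" using m B by simp
    fix \<epsilon> x assume e: "\<epsilon> \<in> ball e (m / B)" and x: "x \<in> {a..b}"
    have "norm ((\<epsilon> - e) *\<^sub>R z x) \<le> \<bar>\<epsilon> - e\<bar> * B" using B(2)[OF x] by (simp add: mult_left_mono)
    also have "\<dots> < m" using e B by (simp add: dist_real_def abs_minus_commute pos_less_divide_eq)
    also have "m \<le> norm (v x + e *\<^sub>R z x)" using x0(2)[OF x] by (simp add: m_def)
    finally have "(\<epsilon> - e) *\<^sub>R z x \<noteq> - (v x + e *\<^sub>R z x)" by (metis norm_minus_cancel less_irrefl)
    then show "v x + \<epsilon> *\<^sub>R z x \<noteq> 0" by (simp add: scaleR_left_diff_distrib eq_neg_iff_add_eq_0 algebra_simps)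
  qed
next
  case False
  show ?thesis by (rule that[of 1]) (use False in auto)
qed

lemma integral_norm_derivatives:
  fixes v y z :: "real \<Rightarrow> 'a::euclidean_space"
  assumes v: "continuous_on {a..b} v" and z: "continuous_on {a..b} z" and y: "continuous_on {a..b} y"
    and nz: "\<And>x. x \<in> {a..b} \<Longrightarrow> v x + e *\<^sub>R z x \<noteq> 0"
  shows "((\<lambda>\<epsilon>. integral {a..b} (\<lambda>x. norm (v x + \<epsilon> *\<^sub>R z x))) has_real_derivative
      integral {a..b} (\<lambda>x. norm_d1 (v x + e *\<^sub>R z x) (z x))) (at e)"
    and "((\<lambda>\<epsilon>. integral {a..b} (\<lambda>x. norm_d1 (v x + \<epsilon> *\<^sub>R z x) (y x))) has_real_derivative
      integral {a..b} (\<lambda>x. norm_d2 (v x + e *\<^sub>R z x) (y x) (z x))) (at e)"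
proof -
  obtain r where r: "0 < r" "\<And>\<epsilon> x. \<epsilon> \<in> ball e r \<Longrightarrow> x \<in> {a..b} \<Longrightarrow> v x + \<epsilon> *\<^sub>R z x \<noteq> 0"
    using nonvanishing_nearby[OF v z nz] by blast
  have snd: "continuous_on (ball e r \<times> {a..b}) (\<lambda>p. w (snd p))" if "continuous_on {a..b} w" for w :: "real \<Rightarrow> 'a"
    by (rule continuous_on_compose2[OF that]) (auto intro!: continuous_intros)
  have pair: "continuous_on (ball e r \<times> {a..b}) (\<lambda>p. v (snd p) + fst p *\<^sub>R z (snd p))"
    by (intro continuous_intros snd v z)
  have sl: "continuous_on {a..b} (\<lambda>x. v x + \<epsilon> *\<^sub>R z x)" for \<epsilon> by (intro continuous_intros v z)
  have e: "e \<in> ball e r" using r by simp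
  have "((\<lambda>\<epsilon>. integral (cbox a b) (\<lambda>x. norm (v x + \<epsilon> *\<^sub>R z x))) has_real_derivative
      integral (cbox a b) (\<lambda>x. norm_d1 (v x + e *\<^sub>R z x) (z x))) (at e within ball e r)"
  proof (rule leibniz_rule_field_derivative)
    show "continuous_on (ball e r \<times> cbox a b) (\<lambda>(\<epsilon>, x). norm_d1 (v x + \<epsilon> *\<^sub>R z x) (z x))"
      unfolding case_prod_unfold box_real using r(2) by (intro continuous_on_norm_d1 pair snd z) auto
    show "((\<lambda>\<epsilon>. norm (v x + \<epsilon> *\<^sub>R z x)) has_real_derivative norm_d1 (v x + \<epsilon> *\<^sub>R z x) (z x))
      (at \<epsilon> within ball e r)" if "\<epsilon> \<in> ball e r" "x \<in> cbox a b" for \<epsilon> x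
      by (rule has_field_derivative_at_within[OF has_real_derivative_norm_line[OF r(2)]]) (use that in auto)
    show "(\<lambda>x. norm (v x + \<epsilon> *\<^sub>R z x)) integrable_on cbox a b" if "\<epsilon> \<in> ball e r" for \<epsilon>
      unfolding box_real by (intro integrable_continuous_real continuous_intros v z)
  qed (use e in auto)
  then show "((\<lambda>\<epsilon>. integral {a..b} (\<lambda>x. norm (v x + \<epsilon> *\<^sub>R z x))) has_real_derivative
      integral {a..b} (\<lambda>x. norm_d1 (v x + e *\<^sub>R z x) (z x))) (at e)"
    unfolding at_within_open[OF e open_ball] box_real .
  have "((\<lambda>\<epsilon>. integral (cbox a b) (\<lambda>x. norm_d1 (v x + \<epsilon> *\<^sub>R z x) (y x))) has_real_derivative
      integral (cbox a b) (\<lambda>x. norm_d2 (v x + e *\<^sub>R z x) (y x) (z x))) (at e within ball e r)"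
  proof (rule leibniz_rule_field_derivative)
    show "continuous_on (ball e r \<times> cbox a b) (\<lambda>(\<epsilon>, x). norm_d2 (v x + \<epsilon> *\<^sub>R z x) (y x) (z x))"
      unfolding case_prod_unfold box_real using r(2) by (intro continuous_on_norm_d2 pair snd z y) auto
    show "((\<lambda>\<epsilon>. norm_d1 (v x + \<epsilon> *\<^sub>R z x) (y x)) has_real_derivative norm_d2 (v x + \<epsilon> *\<^sub>R z x) (y x) (z x))
      (at \<epsilon> within ball e r)" if "\<epsilon> \<in> ball e r" "x \<in> cbox a b" for \<epsilon> x
      by (rule has_field_derivative_at_within[OF has_real_derivative_norm_d1_line[OF r(2)]]) (use that in auto)
    show "(\<lambda>x. norm_d1 (v x + \<epsilon> *\<^sub>R z x) (y x)) integrable_on cbox a b" if "\<epsilon> \<in> ball e r" for \<epsilon>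
      unfolding box_real using r(2) that by (intro integrable_continuous_real continuous_on_norm_d1 sl y) auto
  qed (use e in auto)
  then show "((\<lambda>\<epsilon>. integral {a..b} (\<lambda>x. norm_d1 (v x + \<epsilon> *\<^sub>R z x) (y x))) has_real_derivative
      integral {a..b} (\<lambda>x. norm_d2 (v x + e *\<^sub>R z x) (y x) (z x))) (at e)"
    unfolding at_within_open[OF e open_ball] box_real .
qed

lemma integral_norm_pos:
  fixes v :: "real \<Rightarrow> 'a::euclidean_space"
  assumes "continuous_on {a..b} v" "integral {a..b} v \<noteq> 0"
  shows "norm (integral {a..b} v) \<le> integral {a..b} (\<lambda>x. norm (v x))"
    "0 < integral {a..b} (\<lambda>x. norm (v x))"
proof -
  show "norm (integral {a..b} v) \<le> integral {a..b} (\<lambda>x. norm (v x))"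
    by (intro Henstock_Kurzweil_Integration.integral_norm_bound_integral integrable_continuous_real
        continuous_intros assms) simp
  then show "0 < integral {a..b} (\<lambda>x. norm (v x))" using assms(2) by (smt (verit) zero_less_norm_iff)
qed

lemma defect_derivatives:
  fixes v y z :: "real \<Rightarrow> 'a::euclidean_space"
  assumes v: "continuous_on {a..b} v" and z: "continuous_on {a..b} z" and y: "continuous_on {a..b} y"
    and nz: "\<And>x. x \<in> {a..b} \<Longrightarrow> v x + e *\<^sub>R z x \<noteq> 0"
    and nz': "integral {a..b} (\<lambda>x. v x + e *\<^sub>R z x) \<noteq> 0"
  shows "((\<lambda>\<epsilon>. defect0 \<alpha> a b (\<lambda>x. v x + \<epsilon> *\<^sub>R z x)) has_real_derivative
      defect1 \<alpha> a b (\<lambda>x. v x + e *\<^sub>R z x) z) (at e)"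
    and "((\<lambda>\<epsilon>. defect1 \<alpha> a b (\<lambda>x. v x + \<epsilon> *\<^sub>R z x) y) has_real_derivative
      defect2 \<alpha> a b (\<lambda>x. v x + e *\<^sub>R z x) y z) (at e)"
proof -
  \<comment> \<open>The chord vector is affine in \<open>\<epsilon>\<close>, so the derivatives of
    the norm along lines apply to it directly; only the arc length is differentiated under the
    integral.\<close>
  have I: "integral {a..b} (\<lambda>x. v x + \<epsilon> *\<^sub>R z x) = integral {a..b} v + \<epsilon> *\<^sub>R integral {a..b} z" for \<epsilon>
    by (simp add: Henstock_Kurzweil_Integration.integral_add integrable_continuous_real
        continuous_intros v z)
  have sl: "continuous_on {a..b} (\<lambda>x. v x + e *\<^sub>R z x)" by (intro continuous_intros v z)
  note pos = integral_norm_pos(2)[OF sl nz']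
  note nz'' = nz'[unfolded I]
  have n: "0 < norm (integral {a..b} v + e *\<^sub>R integral {a..b} z)" using nz'' by simp
  note D = integral_norm_derivatives[OF v z y nz]
  note E = has_real_derivative_norm_line[OF nz''] has_real_derivative_norm_d1_line[OF nz'']
  show "((\<lambda>\<epsilon>. defect0 \<alpha> a b (\<lambda>x. v x + \<epsilon> *\<^sub>R z x)) has_real_derivative
      defect1 \<alpha> a b (\<lambda>x. v x + e *\<^sub>R z x) z) (at e)"
    unfolding defect0_def defect1_def I
    by (intro DERIV_diff has_real_derivative_powr_comp D E n pos)
  show "((\<lambda>\<epsilon>. defect1 \<alpha> a b (\<lambda>x. v x + \<epsilon> *\<^sub>R z x) y) has_real_derivative
      defect2 \<alpha> a b (\<lambda>x. v x + e *\<^sub>R z x) y z) (at e)"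
    unfolding defect1_def defect2_def I
    by (intro DERIV_diff has_real_derivative_powr_d1_comp D E n pos)
qed

lemma defect0_nonneg:
  fixes v :: "real \<Rightarrow> 'a::euclidean_space"
  assumes "0 < \<alpha>" "continuous_on {a..b} v" "integral {a..b} v \<noteq> 0"
  shows "0 \<le> defect0 \<alpha> a b v"
  unfolding defect0_def using integral_norm_pos[OF assms(2,3)] assms(1,3)
  by (simp add: powr_mono2')

lemma tame_nonzero:
  assumes "tame c M \<omega> a b v y z" "0 < c"
  shows "\<And>x. x \<in> {a..b} \<Longrightarrow> v x \<noteq> 0" "integral {a..b} v \<noteq> 0"
  using tameD[OF assms(1)] assms(2) by (fastforce simp: triples_def avg_def)+

lemma integral_eq_avg: "a < b \<Longrightarrow> integral {a..b} w = (b - a) *\<^sub>R avg a b w"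
  by (simp add: avg_def)

lemma defects_bound:
  fixes \<alpha> c M K :: real
  assumes c: "0 < c"
  obtains C where "0 \<le> C" "\<And>a b (v :: real \<Rightarrow> 'a::euclidean_space) y z. tame c M (K * (b - a) powr (\<alpha> / 2)) a b v y z \<Longrightarrow>
    \<bar>defect0 \<alpha> a b v\<bar> \<le> C \<and> \<bar>defect1 \<alpha> a b v y\<bar> \<le> C \<and> \<bar>defect2 \<alpha> a b v y z\<bar> \<le> C"
proof -
  obtain C1 where C1: "0 \<le> C1"
    "\<And>a b \<omega> (v :: real \<Rightarrow> 'a::euclidean_space) y z. tame c M \<omega> a b v y z \<Longrightarrow>
       \<bar>avg a b (\<lambda>x. norm (v x)) - norm (avg a b v)\<bar> \<le> C1 * \<omega>\<^sup>2 \<and>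
       \<bar>avg a b (\<lambda>x. norm_d1 (v x) (y x)) - norm_d1 (avg a b v) (avg a b y)\<bar> \<le> C1 * \<omega>\<^sup>2 \<and>
       \<bar>avg a b (\<lambda>x. norm_d2 (v x) (y x) (z x)) - norm_d2 (avg a b v) (avg a b y) (avg a b z)\<bar> \<le> C1 * \<omega>\<^sup>2"
    using avg_norm_derivs_bound[OF c] by blast
  \<comment> \<open>\<open>M'\<close> also has to bound the second variations of the norm, and
    \<open>norm_d2_bound\<close> gives \<open>2 * M * M / c\<close> for them.\<close>
  define M' where "M' = M + 2 * M * M / c"
  obtain C2 where C2: "0 \<le> C2"
    "\<And>x x' y y' z z' w w' \<delta>. \<lbrakk>c \<le> x; x \<le> M'; c \<le> x'; x' \<le> M'; \<bar>y\<bar> \<le> M'; \<bar>y'\<bar> \<le> M'; \<bar>z\<bar> \<le> M'; \<bar>z'\<bar> \<le> M';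
      \<bar>w\<bar> \<le> M'; \<bar>w'\<bar> \<le> M'; \<bar>x - x'\<bar> \<le> \<delta>; \<bar>y - y'\<bar> \<le> \<delta>; \<bar>z - z'\<bar> \<le> \<delta>; \<bar>w - w'\<bar> \<le> \<delta>\<rbrakk> \<Longrightarrow>
      \<bar>x powr - \<alpha> - x' powr - \<alpha>\<bar> \<le> C2 * \<delta> \<and>
      \<bar>powr_d1 \<alpha> x y - powr_d1 \<alpha> x' y'\<bar> \<le> C2 * \<delta> \<and>
      \<bar>powr_d2 \<alpha> x y z w - powr_d2 \<alpha> x' y' z' w'\<bar> \<le> C2 * \<delta>"
    by (rule powr_derivs_lipschitz[OF c, where M = M' and \<alpha> = \<alpha>]) (rule that)
  \<comment> \<open>Lipschitz constant times closeness of the means. The length \<open>h\<close> is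
    absent because \<open>h powr - \<alpha>\<close> cancels against
    \<open>\<omega>\<^sup>2 = K\<^sup>2 * h powr \<alpha>\<close>.\<close>
  define C where "C = C2 * (C1 * K\<^sup>2)"
  show ?thesis
  proof (rule that[of C])
    show "0 \<le> C" using C1(1) C2(1) by (simp add: C_def)
    fix a b and v y z :: "real \<Rightarrow> 'a"
    assume t: "tame c M (K * (b - a) powr (\<alpha> / 2)) a b v y z"
    note T = tameD[OF t]
    note ab = T(1)
    define h where "h = b - a"
    have h: "0 < h" using ab by (simp add: h_def)
    define \<omega> where "\<omega> = K * h powr (\<alpha> / 2)"
    have \<omega>2: "\<omega>\<^sup>2 = K\<^sup>2 * h powr \<alpha>"
      by (simp add: \<omega>_def power_mult_distrib power2_eq_square powr_add[symmetric])
    note J = C1(2)[OF t]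
    have nz: "v x \<noteq> 0" if "x \<in> {a..b}" for x using tame_nonzero(1)[OF t c] that by blast
    have cm: "\<And>x. x \<in> {a..b} \<Longrightarrow> norm (v x) \<le> M" "\<And>x. x \<in> {a..b} \<Longrightarrow> norm (y x) \<le> M"
      "\<And>x. x \<in> {a..b} \<Longrightarrow> norm (z x) \<le> M" "\<And>x. x \<in> {a..b} \<Longrightarrow> c \<le> norm (v x)"
      using T(5) by (auto simp: triples_def)
    have cM: "c \<le> M" using cm(1,4)[of a] ab by fastforce
    have MM: "M \<le> M'" "2 * M * M / c \<le> M'" using c cM by (auto simp: M'_def)
    define u where "u = avg a b v"
    define n where "n = avg a b (\<lambda>x. norm (v x))"
    define ny where "ny = avg a b (\<lambda>x. norm_d1 (v x) (y x))"
    define nz where "nz = avg a b (\<lambda>x. norm_d1 (v x) (z x))"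
    define nyz where "nyz = avg a b (\<lambda>x. norm_d2 (v x) (y x) (z x))"
    have u: "c \<le> norm u" "norm u \<le> M" using T(6) norm_avg_le[OF ab T(2) cm(1)] by (auto simp: u_def)
    have u0: "u \<noteq> 0" using u c by auto
    have uy: "norm (avg a b y) \<le> M" and uz: "norm (avg a b z) \<le> M"
      using norm_avg_le[OF ab T(3) cm(2)] norm_avg_le[OF ab T(4) cm(3)] by auto
    have d1: "\<bar>norm_d1 w w'\<bar> \<le> M'" if "w \<noteq> 0" "norm w' \<le> M" for w w' :: 'a
      using norm_d1_bound[OF that(1), of w'] that(2) MM by linarith
    have d2: "\<bar>norm_d2 w w' w''\<bar> \<le> M'" if "c \<le> norm w" "norm w' \<le> M" "norm w'' \<le> M" for w w' w'' :: 'a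
    proof -
      have "\<bar>norm_d2 w w' w''\<bar> \<le> 2 * norm w' * norm w'' / norm w" using that c by (intro norm_d2_bound) auto
      also have "\<dots> \<le> 2 * M * M / c" using that c cM by (intro frac_le mult_mono) auto
      finally show ?thesis using MM by linarith
    qed
    have cn: "continuous_on {a..b} (\<lambda>x. norm (v x))" "continuous_on {a..b} (\<lambda>x. norm_d1 (v x) (y x))"
      "continuous_on {a..b} (\<lambda>x. norm_d1 (v x) (z x))" "continuous_on {a..b} (\<lambda>x. norm_d2 (v x) (y x) (z x))"
      by (intro continuous_intros continuous_on_norm_d1 continuous_on_norm_d2 T nz; assumption)+
    have n: "c \<le> n" "n \<le> M"
    proof -
      have "norm n \<le> M" unfolding n_def by (rule norm_avg_le[OF ab cn(1)]) (use cm in auto)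
      then show "n \<le> M" by simp
      have "norm (integral {a..b} v) \<le> integral {a..b} (\<lambda>x. norm (v x))"
        by (rule integral_norm_pos(1)[OF T(2) tame_nonzero(2)[OF t c]])
      then have "norm u \<le> n" using ab unfolding u_def n_def avg_def by (simp add: divide_right_mono)
      then show "c \<le> n" using u by linarith
    qed
    have nb: "\<bar>ny\<bar> \<le> M'" "\<bar>nz\<bar> \<le> M'" "\<bar>nyz\<bar> \<le> M'"
      using norm_avg_le[OF ab cn(2), of M'] norm_avg_le[OF ab cn(3), of M'] norm_avg_le[OF ab cn(4), of M']
        d1[OF nz cm(2)] d1[OF nz cm(3)] d2[OF cm(4) cm(2,3)]
      unfolding ny_def nz_def nyz_def real_norm_def by blast+
    have close: "\<bar>norm u - n\<bar> \<le> C1 * \<omega>\<^sup>2" "\<bar>norm_d1 u (avg a b y) - ny\<bar> \<le> C1 * \<omega>\<^sup>2"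
      "\<bar>norm_d1 u (avg a b z) - nz\<bar> \<le> C1 * \<omega>\<^sup>2" "\<bar>norm_d2 u (avg a b y) (avg a b z) - nyz\<bar> \<le> C1 * \<omega>\<^sup>2"
    proof -
      \<comment> \<open>The estimate for \<open>norm_d1\<close> only concerns the first direction;
        exchanging the directions supplies it for \<open>z\<close>.\<close>
      note J' = C1(2)[OF tame_swap[OF t]]
      show "\<bar>norm u - n\<bar> \<le> C1 * \<omega>\<^sup>2" "\<bar>norm_d1 u (avg a b y) - ny\<bar> \<le> C1 * \<omega>\<^sup>2"
        "\<bar>norm_d1 u (avg a b z) - nz\<bar> \<le> C1 * \<omega>\<^sup>2"
        "\<bar>norm_d2 u (avg a b y) (avg a b z) - nyz\<bar> \<le> C1 * \<omega>\<^sup>2"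
        using J J' unfolding u_def n_def ny_def nz_def nyz_def \<omega>_def h_def
        by (simp_all only: abs_minus_commute)
    qed
    have lip: "\<bar>norm u powr - \<alpha> - n powr - \<alpha>\<bar> \<le> C2 * (C1 * \<omega>\<^sup>2) \<and>
      \<bar>powr_d1 \<alpha> (norm u) (norm_d1 u (avg a b y)) - powr_d1 \<alpha> n ny\<bar> \<le> C2 * (C1 * \<omega>\<^sup>2) \<and>
      \<bar>powr_d2 \<alpha> (norm u) (norm_d1 u (avg a b y)) (norm_d1 u (avg a b z)) (norm_d2 u (avg a b y) (avg a b z))
         - powr_d2 \<alpha> n ny nz nyz\<bar> \<le> C2 * (C1 * \<omega>\<^sup>2)"
    proof (rule C2(2))
      show "norm u \<le> M'" "n \<le> M'" using u n MM by linarith+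
    qed (fact u n nb close d1[OF u0 uy] d1[OF u0 uz] d2[OF u(1) uy uz])+
    have I: "integral {a..b} w = h *\<^sub>R avg a b w" for w :: "real \<Rightarrow> 'b::euclidean_space"
      unfolding h_def by (rule integral_eq_avg[OF ab])
    have I': "integral {a..b} w = h * avg a b w" for w :: "real \<Rightarrow> real"
      using I[of w] by simp
    have sc: "h powr - \<alpha> * (C2 * (C1 * \<omega>\<^sup>2)) = C"
      using h by (simp add: \<omega>2 C_def powr_minus field_simps)
    have fin: "\<bar>h powr - \<alpha> * s - h powr - \<alpha> * t\<bar> \<le> C" if "\<bar>s - t\<bar> \<le> C2 * (C1 * \<omega>\<^sup>2)" for s t
      using mult_left_mono[OF that, of "h powr - \<alpha>"] sc by (simp add: right_diff_distrib[symmetric] abs_mult)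
    have un: "0 < norm u" "0 < n" using u n c by auto
    have "defect0 \<alpha> a b v = h powr - \<alpha> * norm u powr - \<alpha> - h powr - \<alpha> * n powr - \<alpha>"
      unfolding defect0_def I I' u_def[symmetric] n_def[symmetric] using h un by (simp add: powr_mult)
    moreover have "defect1 \<alpha> a b v y = h powr - \<alpha> * powr_d1 \<alpha> (norm u) (norm_d1 u (avg a b y)) - h powr - \<alpha> * powr_d1 \<alpha> n ny"
      unfolding defect1_def I I' u_def[symmetric] n_def[symmetric] ny_def[symmetric]
      using h un by (simp add: powr_d1_scale norm_d1_scale)
    moreover have "defect2 \<alpha> a b v y z = h powr - \<alpha> * powr_d2 \<alpha> (norm u) (norm_d1 u (avg a b y)) (norm_d1 u (avg a b z)) (norm_d2 u (avg a b y) (avg a b z)) - h powr - \<alpha> * powr_d2 \<alpha> n ny nz nyz"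
      unfolding defect2_def I I' u_def[symmetric] n_def[symmetric] ny_def[symmetric] nz_def[symmetric] nyz_def[symmetric]
      using h un by (simp add: powr_d2_scale norm_d1_scale norm_d2_scale)
    ultimately show "\<bar>defect0 \<alpha> a b v\<bar> \<le> C \<and> \<bar>defect1 \<alpha> a b v y\<bar> \<le> C \<and> \<bar>defect2 \<alpha> a b v y z\<bar> \<le> C"
      using lip by (simp only: fin)
  qed
qed

section \<open>Perturbed arcs and the bound for the squared first variation\<close>

lemma tame_perturb:
  fixes v y z :: "real \<Rightarrow> 'a::euclidean_space"
  assumes t: "tame c M \<omega> a b v y z" and c: "0 < c" and e: "\<bar>\<epsilon>\<bar> * (2 * M) \<le> c"
  shows "tame (c / 2) (2 * M) (2 * \<omega>) a b (\<lambda>x. v x + \<epsilon> *\<^sub>R y x) y z"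
proof -
  note T = tameD[OF t]
  have M: "\<And>x. x \<in> {a..b} \<Longrightarrow> norm (v x) \<le> M" "\<And>x. x \<in> {a..b} \<Longrightarrow> norm (y x) \<le> M"
      "\<And>x. x \<in> {a..b} \<Longrightarrow> norm (z x) \<le> M" "\<And>x. x \<in> {a..b} \<Longrightarrow> c \<le> norm (v x)"
      using T(5) by (auto simp: triples_def)
  have cM: "c \<le> M" using M(1,4)[of a] T(1) by fastforce
  have M0: "0 < M" using cM c by simp
  \<comment> \<open>As \<open>c \<le> M\<close>, the restriction on \<open>\<epsilon>\<close> also
    gives \<open>\<bar>\<epsilon>\<bar> \<le> 1\<close>. Hence \<open>M\<close> and
    \<open>\<omega>\<close> at most double, while the lower bounds lose at most half because
    \<open>\<epsilon> *\<^sub>R y x\<close> has norm at most \<open>c / 2\<close>.\<close>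
  have "0 \<le> \<bar>\<epsilon>\<bar> * M" using M0 by simp
  then have "\<bar>\<epsilon>\<bar> * M \<le> 1 * M" using e cM by simp
  then have e1: "\<bar>\<epsilon>\<bar> \<le> 1" using M0 by (rule mult_right_le_imp_le)
  have ey: "norm (\<epsilon> *\<^sub>R w) \<le> c / 2" if "norm w \<le> M" for w :: 'a
    using mult_left_mono[OF that, of "\<bar>\<epsilon>\<bar>"] e by simp
  have \<omega>: "0 \<le> \<omega>" using T(7)[of a a] T(1) by simp
  have y: "norm (avg a b y) \<le> M" by (rule norm_avg_le[OF T(1) T(3) M(2)])
  have av: "avg a b (\<lambda>x. v x + \<epsilon> *\<^sub>R y x) = avg a b v + \<epsilon> *\<^sub>R avg a b y"
    by (simp add: avg_def Henstock_Kurzweil_Integration.integral_add integrable_continuous_real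
        continuous_intros T scaleR_add_right scaleR_left_commute)
  show ?thesis unfolding tame_def
  proof (intro conjI ballI)
    show "c / 2 \<le> norm (avg a b (\<lambda>x. v x + \<epsilon> *\<^sub>R y x))"
      unfolding av using norm_diff_ineq[of "avg a b v" "\<epsilon> *\<^sub>R avg a b y"] ey[OF y] T(6) by linarith
    fix x assume x: "x \<in> {a..b}"
    show "(v x + \<epsilon> *\<^sub>R y x, y x, z x) \<in> triples (c / 2) (2 * M)"
      using norm_diff_ineq[of "v x" "\<epsilon> *\<^sub>R y x"] norm_triangle_ineq[of "v x" "\<epsilon> *\<^sub>R y x"]
        ey[OF M(2)[OF x]] M[OF x] cM M0 unfolding triples_def by auto
    fix x' assume x': "x' \<in> {a..b}"
    have "norm (v x + \<epsilon> *\<^sub>R y x - (v x' + \<epsilon> *\<^sub>R y x')) \<le> norm (v x - v x') + norm (\<epsilon> *\<^sub>R (y x - y x'))"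
      by (rule order_trans[OF eq_refl norm_triangle_ineq]) (simp add: algebra_simps)
    also have "norm (\<epsilon> *\<^sub>R (y x - y x')) \<le> 1 * norm (y x - y x')"
      unfolding norm_scaleR by (intro mult_right_mono e1) simp
    finally show "norm (v x + \<epsilon> *\<^sub>R y x - (v x' + \<epsilon> *\<^sub>R y x')) \<le> 2 * \<omega>"
      using T(7)[OF x x'] T(8)[OF x x'] by simp
    show "norm (y x - y x') \<le> 2 * \<omega>" "norm (z x - z x') \<le> 2 * \<omega>"
      using T(8)[OF x x'] T(9)[OF x x'] \<omega> by auto
  qed (intro T continuous_intros)+
qed

text \<open>A step against the sign of \<open>g' 0\<close> lowers \<open>g\<close> by an amount of
  order \<open>(g' 0)\<^sup>2\<close>, up to a quadratic error; since \<open>g\<close> cannot become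
  negative, \<open>g 0\<close> must be at least that large. The bound on \<open>g' 0\<close> keeps
  the step inside the interval.\<close>

lemma square_deriv_le:
  fixes g g' g'' :: "real \<Rightarrow> real"
  assumes r: "0 < r" and C: "0 < C"
    and d1: "\<And>t. \<bar>t\<bar> \<le> r \<Longrightarrow> (g has_real_derivative g' t) (at t)"
    and d2: "\<And>t. \<bar>t\<bar> \<le> r \<Longrightarrow> (g' has_real_derivative g'' t) (at t)"
    and pos: "\<And>t. \<bar>t\<bar> \<le> r \<Longrightarrow> 0 \<le> g t"
    and bd: "\<bar>g' 0\<bar> \<le> C" "\<And>t. \<bar>t\<bar> \<le> r \<Longrightarrow> \<bar>g'' t\<bar> \<le> C"
  shows "(g' 0)\<^sup>2 \<le> 2 * (C / r + C) * g 0"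
proof (cases "g' 0 = 0")
  case True
  then show ?thesis using pos[of 0] r C by simp
next
  case False
  \<comment> \<open>The step length is \<open>k * \<bar>g' 0\<bar>\<close>. This \<open>k\<close>
    satisfies both requirements: \<open>k * C \<le> r\<close> keeps the step in the interval, and
    \<open>k * C \<le> 1\<close> lets the Taylor error consume at most half of the gain.\<close>
  define k where "k = inverse (C / r + C)"
  have S: "0 < C / r + C" "C \<le> r * (C / r + C)" "C \<le> C / r + C" using r C by (simp_all add: distrib_left add_pos_pos)
  have k: "0 < k" "k * C \<le> r" "k * C \<le> 1"
    using S by (simp_all add: k_def divide_inverse[symmetric] mult.commute[of "inverse _"] pos_divide_le_eq)
  define x where "x = - (k * g' 0)"
  have "\<bar>x\<bar> = k * \<bar>g' 0\<bar>" using k(1) by (simp add: x_def abs_mult)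
  also have "\<dots> \<le> k * C" using bd(1) k(1) by simp
  finally have xr: "\<bar>x\<bar> \<le> r" using k by linarith
  have x0: "x \<noteq> 0" using False k by (simp add: x_def)
  define D where "D m = (if m = 0 then g else if m = 1 then g' else g'')" for m :: nat
  have "\<exists>t. (if x < 0 then x < t \<and> t < 0 else 0 < t \<and> t < x) \<and>
      g x = (\<Sum>m<2. (D m 0 / fact m) * (x - 0) ^ m) + (D 2 t / fact 2) * (x - 0) ^ 2"
    by (rule Taylor[of 2 D g "- r" r]) (use x0 xr r d1 d2 in \<open>auto simp: D_def less_2_cases_iff\<close>)
  then obtain t where t': "if x < 0 then x < t \<and> t < 0 else 0 < t \<and> t < x"
    "g x = (\<Sum>m<2. (D m 0 / fact m) * (x - 0) ^ m) + (D 2 t / fact 2) * (x - 0) ^ 2" by blast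
  have t: "\<bar>t\<bar> \<le> \<bar>x\<bar>" "g x = g 0 + g' 0 * x + g'' t / 2 * x\<^sup>2"
    using t' by (auto simp: D_def numeral_2_eq_2 split: if_splits)
  have "g'' t \<le> C" using bd(2)[of t] t(1) xr by linarith
  then have "g'' t / 2 * x\<^sup>2 \<le> C / 2 * x\<^sup>2" by (intro mult_right_mono) auto
  then have "0 \<le> g 0 + g' 0 * x + C / 2 * x\<^sup>2" using pos[OF xr] t(2) by linarith
  also have "\<dots> = g 0 - k * (g' 0)\<^sup>2 + (k * C) * (k * (g' 0)\<^sup>2) / 2"
    by (simp add: x_def power2_eq_square algebra_simps)
  also have "\<dots> \<le> g 0 - k * (g' 0)\<^sup>2 + 1 * (k * (g' 0)\<^sup>2) / 2"
    using k by (intro add_left_mono divide_right_mono mult_right_mono) auto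
  finally have "k * (g' 0)\<^sup>2 \<le> 2 * g 0" by simp
  then have "(g' 0)\<^sup>2 \<le> 2 * g 0 / k" using k(1) by (simp add: field_simps)
  then show ?thesis unfolding k_def divide_inverse inverse_inverse_eq by (simp only: mult_ac)
qed

lemma defect1_square_bound:
  fixes \<alpha> c M K :: real
  assumes \<alpha>: "0 < \<alpha>" and c: "0 < c"
  obtains C where "0 \<le> C" "\<And>a b (v :: real \<Rightarrow> 'a::euclidean_space) y z. tame c M (K * (b - a) powr (\<alpha> / 2)) a b v y z \<Longrightarrow>
    (defect1 \<alpha> a b v y)\<^sup>2 \<le> C * defect0 \<alpha> a b v"
proof -
  have c2: "0 < c / 2" using c by simp
  obtain C where C: "0 \<le> C" "\<And>a b (v :: real \<Rightarrow> 'a) y z. tame (c / 2) (2 * M) (2 * K * (b - a) powr (\<alpha> / 2)) a b v y z \<Longrightarrow>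
    \<bar>defect0 \<alpha> a b v\<bar> \<le> C \<and> \<bar>defect1 \<alpha> a b v y\<bar> \<le> C \<and> \<bar>defect2 \<alpha> a b v y z\<bar> \<le> C"
    using defects_bound[OF c2] by blast
  \<comment> \<open>\<open>square_deriv_le\<close> asks for a strictly positive bound, and
    \<open>C\<close> may be 0. The radius \<open>r\<close> is positive for every \<open>M\<close>,
    satisfies \<open>r * (2 * M) \<le> c\<close> as \<open>tame_perturb\<close> requires, and does
    not depend on the arc.\<close>
  define B where "B = C + 1"
  define r where "r = c / (2 * \<bar>M\<bar> + 1)"
  have B: "0 < B" and r: "0 < r" using C(1) c by (simp_all add: B_def r_def)
  show ?thesis
  proof (rule that[of "2 * (B / r + B)"])
    show "0 \<le> 2 * (B / r + B)" using B r by simp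
    fix a b and v y z :: "real \<Rightarrow> 'a"
    assume "tame c M (K * (b - a) powr (\<alpha> / 2)) a b v y z"
    then have t: "tame c M (K * (b - a) powr (\<alpha> / 2)) a b v y y" by (rule tame_same)
    note T = tameD[OF t]
    have p: "tame (c / 2) (2 * M) (2 * K * (b - a) powr (\<alpha> / 2)) a b (\<lambda>x. v x + e *\<^sub>R y x) y y" if "\<bar>e\<bar> \<le> r" for e
    unfolding mult.assoc
    proof (rule tame_perturb[OF t c])
      have "\<bar>e\<bar> * (2 * M) \<le> r * (2 * \<bar>M\<bar> + 1)" using that
        by (intro order_trans[OF mult_left_mono mult_right_mono]) auto
      then show "\<bar>e\<bar> * (2 * M) \<le> c" by (simp add: r_def)
    qed
    have "(defect1 \<alpha> a b (\<lambda>x. v x + 0 *\<^sub>R y x) y)\<^sup>2 \<le> 2 * (B / r + B) * defect0 \<alpha> a b (\<lambda>x. v x + 0 *\<^sub>R y x)"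
    proof (rule square_deriv_le[OF r B])
      fix e assume e: "\<bar>e\<bar> \<le> r"
      note nz = tame_nonzero[OF p[OF e] c2]
      show "((\<lambda>\<epsilon>. defect0 \<alpha> a b (\<lambda>x. v x + \<epsilon> *\<^sub>R y x)) has_real_derivative
         defect1 \<alpha> a b (\<lambda>x. v x + e *\<^sub>R y x) y) (at e)"
        by (rule defect_derivatives(1)[OF T(2,3,3) nz])
      show "((\<lambda>\<epsilon>. defect1 \<alpha> a b (\<lambda>x. v x + \<epsilon> *\<^sub>R y x) y) has_real_derivative
         defect2 \<alpha> a b (\<lambda>x. v x + e *\<^sub>R y x) y y) (at e)"
        by (rule defect_derivatives(2)[OF T(2,3,3) nz])
      show "0 \<le> defect0 \<alpha> a b (\<lambda>x. v x + e *\<^sub>R y x)"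
        by (intro defect0_nonneg \<alpha> nz tameD[OF p[OF e]])
      show "\<bar>defect2 \<alpha> a b (\<lambda>x. v x + e *\<^sub>R y x) y y\<bar> \<le> B" using C(2)[OF p[OF e]] by (simp add: B_def)
    qed (use C(2)[OF p[of 0]] r in \<open>simp add: B_def\<close>)
    then show "(defect1 \<alpha> a b v y)\<^sup>2 \<le> 2 * (B / r + B) * defect0 \<alpha> a b v" by simp
  qed
qed

section \<open>Variations of the weighted power\<close>

text \<open>At \<open>p = 1\<close> the slope at \<open>u = 0\<close> is 1, whereas
  \<open>0 powr 0 = 0\<close>.\<close>

definition powr_slope :: "real \<Rightarrow> real \<Rightarrow> real" where
  "powr_slope p u = (if p = 1 then 1 else u powr (p - 1))"

lemma has_real_derivative_powr_nonneg:
  fixes p u :: real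
  assumes p: "1 \<le> p" and u: "0 \<le> u"
  shows "((\<lambda>u. u powr p) has_real_derivative p * powr_slope p u) (at u within {0..})"
proof -
  consider "p = 1" | "p > 1" "u > 0" | "p > 1" "u = 0" using assms by fastforce
  then show ?thesis
  proof cases
    case 1
    have "((\<lambda>u. u powr p) has_real_derivative 1) (at u within {0..})"
      by (rule has_field_derivative_transform_within[OF DERIV_ident, of 1]) (use u 1 in auto)
    then show ?thesis using 1 by (simp add: powr_slope_def)
  next
    case 2
    then show ?thesis unfolding powr_slope_def
      by (intro has_field_derivative_at_within[OF has_real_derivative_powr[THEN DERIV_cong]]) auto
  next
    case 3
    have "((\<lambda>h. h powr (p - 1)) \<longlongrightarrow> 0) (at 0 within {0..})"
      by (rule tendsto_zero_powrI[OF tendsto_ident_at tendsto_const])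
        (use 3 in \<open>auto simp: eventually_at_filter\<close>)
    then have "((\<lambda>h. (h powr p - 0 powr p) / (h - 0)) \<longlongrightarrow> 0) (at 0 within {0..})"
      by (rule Lim_transform_eventually) (auto simp: eventually_at_filter powr_diff)
    then show ?thesis using 3 by (simp add: has_field_derivative_iff powr_slope_def)
  qed
qed

text \<open>Near \<open>e\<close> the values of \<open>x\<close> stay in the closed half line, so
  the one-sided derivative of the power at 0 suffices for the chain rule.\<close>

lemma has_real_derivative_powr_comp_nonneg:
  fixes x :: "real \<Rightarrow> real"
  assumes p: "1 \<le> p" and x: "(x has_real_derivative x1) (at e)" and pos: "\<forall>\<^sub>F \<epsilon> in nhds e. 0 \<le> x \<epsilon>"
  shows "((\<lambda>\<epsilon>. x \<epsilon> powr p) has_real_derivative p * powr_slope p (x e) * x1) (at e)"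
proof -
  obtain S where S: "open S" "e \<in> S" "\<And>\<epsilon>. \<epsilon> \<in> S \<Longrightarrow> 0 \<le> x \<epsilon>"
    using pos unfolding eventually_nhds by blast
  have "((\<lambda>u. u powr p) has_real_derivative p * powr_slope p (x e)) (at (x e) within x ` S)"
    by (rule DERIV_subset[OF has_real_derivative_powr_nonneg[OF p]]) (use S in auto)
  from DERIV_image_chain[OF this DERIV_subset[OF x]]
  have "((\<lambda>\<epsilon>. x \<epsilon> powr p) has_real_derivative p * powr_slope p (x e) * x1) (at e within S)"
    by (simp add: o_def)
  then show ?thesis unfolding at_within_open[OF S(2,1)] .
qed

text \<open>Caratheodory's form of the derivative: \<open>g t\<close> is
  \<open>h t * (t - x)\<close> with \<open>h\<close> continuous at \<open>x\<close>, and
  \<open>f t * h t\<close> is again continuous there. No differentiability of \<open>f\<close>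
  enters.\<close>

lemma DERIV_mult_isCont_zero:
  fixes f g :: "real \<Rightarrow> real"
  assumes f: "isCont f x" and g: "(g has_real_derivative D) (at x)" "g x = 0"
  shows "((\<lambda>t. f t * g t) has_real_derivative f x * D) (at x)"
proof -
  obtain h where h: "\<And>t. g t - g x = h t * (t - x)" "isCont h x" "h x = D"
    using g(1) unfolding CARAT_DERIV by blast
  show ?thesis unfolding CARAT_DERIV
    by (rule exI[of _ "\<lambda>t. f t * h t"]) (use h(1) g(2) in \<open>auto simp: h(3) intro!: isCont_mult f h(2)\<close>)
qed

lemma deriv_zero_of_min:
  fixes x :: "real \<Rightarrow> real"
  assumes "(x has_real_derivative x1) (at e)" "\<forall>\<^sub>F \<epsilon> in nhds e. 0 \<le> x \<epsilon>" "x e = 0"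
  shows "x1 = 0"
proof -
  obtain d where "0 < d" "\<And>\<epsilon>. dist \<epsilon> e < d \<Longrightarrow> 0 \<le> x \<epsilon>"
    using assms(2) unfolding eventually_nhds_metric by blast
  then show ?thesis using DERIV_local_min[OF assms(1), of d] assms(3) by (simp add: dist_real_def abs_minus_commute)
qed

text \<open>
  If \<open>x e = 0\<close> and \<open>1 < p < 2\<close>, then \<open>powr_slope p \<circ> x\<close> need not be differentiable at \<open>e\<close>; the product
  is, because \<open>y\<close> vanishes there. The junk value \<open>0 powr (p - 2) = 0\<close> then makes the formula correct.
\<close>

lemma has_real_derivative_powr_slope_mult:
  fixes x y :: "real \<Rightarrow> real"
  assumes p: "1 \<le> p" and x: "(x has_real_derivative x1) (at e)" and pos: "\<forall>\<^sub>F \<epsilon> in nhds e. 0 \<le> x \<epsilon>"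
    and y: "(y has_real_derivative y1) (at e)" and zero: "x e = 0 \<Longrightarrow> y e = 0"
  shows "((\<lambda>\<epsilon>. powr_slope p (x \<epsilon>) * y \<epsilon>) has_real_derivative
     (p - 1) * x e powr (p - 2) * x1 * y e + powr_slope p (x e) * y1) (at e)"
proof -
  have "0 \<le> x e" using eventually_nhds_x_imp_x[OF pos] .
  then consider "p = 1" | "p > 1" "x e > 0" | "p > 1" "x e = 0" using p by fastforce
  then show ?thesis
  proof cases
    case 1
    then show ?thesis using y by (simp add: powr_slope_def)
  next
    case 2
    then show ?thesis unfolding powr_slope_def
      using DERIV_mult[OF DERIV_fun_powr[OF x 2(2), of "p - 1"] y] by (simp add: mult_ac add_ac)
  next
    case 3
    have "(x \<longlongrightarrow> 0) (at e)" using DERIV_isCont[OF x] 3 by (simp add: isCont_def)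
    then have "((\<lambda>\<epsilon>. x \<epsilon> powr (p - 1)) \<longlongrightarrow> 0) (at e)"
      by (rule tendsto_zero_powrI[OF _ tendsto_const])
        (use 3 pos in \<open>auto simp: eventually_at_filter elim: eventually_mono\<close>)
    then have "isCont (\<lambda>\<epsilon>. powr_slope p (x \<epsilon>)) e"
      using 3 by (simp add: isCont_def powr_slope_def)
    from DERIV_mult_isCont_zero[OF this y zero] show ?thesis using 3 zero by simp
  qed
qed

section \<open>The two line elements and the energy form along a fixed arc\<close>

definition speed2_d1 ::
  "real \<Rightarrow> real \<Rightarrow> (real \<Rightarrow> 'a::euclidean_space) \<Rightarrow> (real \<Rightarrow> 'a) \<Rightarrow> real" where
  "speed2_d1 s t v y = norm_d1 (v s) (y s) * norm (v t) + norm (v s) * norm_d1 (v t) (y t)"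

definition speed2_d2 ::
  "real \<Rightarrow> real \<Rightarrow> (real \<Rightarrow> 'a::euclidean_space) \<Rightarrow> (real \<Rightarrow> 'a) \<Rightarrow> (real \<Rightarrow> 'a) \<Rightarrow> real" where
  "speed2_d2 s t v y z =
     norm_d2 (v s) (y s) (z s) * norm (v t) + norm_d1 (v s) (y s) * norm_d1 (v t) (z t)
   + (norm_d1 (v s) (z s) * norm_d1 (v t) (y t) + norm (v s) * norm_d2 (v t) (y t) (z t))"

text \<open>The energy form as a function of the velocity alone, with the arc over
  \<open>[a, b]\<close> frozen; it agrees with \<open>energy_form\<close> as long as this arc is the
  shorter one.\<close>

definition form0 ::
  "real \<Rightarrow> real \<Rightarrow> real \<Rightarrow> real \<Rightarrow> real \<Rightarrow> real \<Rightarrow> (real \<Rightarrow> 'a::euclidean_space) \<Rightarrow> real" where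
  "form0 \<alpha> p a b s t v = defect0 \<alpha> a b v powr p * (norm (v s) * norm (v t))"

definition form1 ::
  "real \<Rightarrow> real \<Rightarrow> real \<Rightarrow> real \<Rightarrow> real \<Rightarrow> real \<Rightarrow> (real \<Rightarrow> 'a::euclidean_space) \<Rightarrow> (real \<Rightarrow> 'a) \<Rightarrow> real"
  where
  "form1 \<alpha> p a b s t v y =
     p * (powr_slope p (defect0 \<alpha> a b v) * defect1 \<alpha> a b v y) * (norm (v s) * norm (v t))
   + defect0 \<alpha> a b v powr p * speed2_d1 s t v y"

definition form2 ::
  "real \<Rightarrow> real \<Rightarrow> real \<Rightarrow> real \<Rightarrow> real \<Rightarrow> real \<Rightarrow>
    (real \<Rightarrow> 'a::euclidean_space) \<Rightarrow> (real \<Rightarrow> 'a) \<Rightarrow> (real \<Rightarrow> 'a) \<Rightarrow> real" where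
  "form2 \<alpha> p a b s t v y z =
     p * ((p - 1) * defect0 \<alpha> a b v powr (p - 2) * defect1 \<alpha> a b v z * defect1 \<alpha> a b v y
       + powr_slope p (defect0 \<alpha> a b v) * defect2 \<alpha> a b v y z) * (norm (v s) * norm (v t))
   + p * (powr_slope p (defect0 \<alpha> a b v) * defect1 \<alpha> a b v y) * speed2_d1 s t v z
   + (p * (powr_slope p (defect0 \<alpha> a b v) * defect1 \<alpha> a b v z) * speed2_d1 s t v y
     + defect0 \<alpha> a b v powr p * speed2_d2 s t v y z)"

text \<open>The conditions at \<open>s\<close> and \<open>t\<close> are separate because the arc may
  run between shifted parameters such as \<open>t + L\<close> and \<open>s + L\<close>, so that
  \<open>s\<close> or \<open>t\<close> lies outside \<open>[a, b]\<close>.\<close>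

definition regular :: "real \<Rightarrow> real \<Rightarrow> real \<Rightarrow> real \<Rightarrow> (real \<Rightarrow> 'a::euclidean_space) \<Rightarrow> bool" where
  "regular a b s t v \<longleftrightarrow> continuous_on {a..b} v \<and> (\<forall>x\<in>{a..b}. v x \<noteq> 0) \<and>
     integral {a..b} v \<noteq> 0 \<and> v s \<noteq> 0 \<and> v t \<noteq> 0"

lemma defect0_nonneg_nearby:
  fixes v z :: "real \<Rightarrow> 'a::euclidean_space"
  assumes "0 < \<alpha>" and v: "continuous_on {a..b} v" and z: "continuous_on {a..b} z"
    and nz: "integral {a..b} v \<noteq> 0"
  shows "\<forall>\<^sub>F \<epsilon> in nhds 0. 0 \<le> defect0 \<alpha> a b (\<lambda>x. v x + \<epsilon> *\<^sub>R z x)"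
proof -
  have I: "integral {a..b} (\<lambda>x. v x + \<epsilon> *\<^sub>R z x) = integral {a..b} v + \<epsilon> *\<^sub>R integral {a..b} z" for \<epsilon>
    by (simp add: Henstock_Kurzweil_Integration.integral_add integrable_continuous_real
        continuous_intros v z)
  have "((\<lambda>\<epsilon>. integral {a..b} v + \<epsilon> *\<^sub>R integral {a..b} z) \<longlongrightarrow> integral {a..b} v + 0 *\<^sub>R integral {a..b} z) (nhds 0)"
    by (intro tendsto_intros filterlim_ident)
  then have "\<forall>\<^sub>F \<epsilon> in nhds 0. integral {a..b} v + \<epsilon> *\<^sub>R integral {a..b} z \<noteq> 0"
    by (rule tendsto_imp_eventually_ne) (use nz in simp)
  then show ?thesis
    by (rule eventually_mono) (intro defect0_nonneg assms continuous_intros, simp add: I)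
qed

lemma speed2_derivatives:
  fixes v y z :: "real \<Rightarrow> 'a::euclidean_space"
  assumes "v s \<noteq> 0" "v t \<noteq> 0"
  shows "((\<lambda>\<epsilon>. norm (v s + \<epsilon> *\<^sub>R z s) * norm (v t + \<epsilon> *\<^sub>R z t)) has_real_derivative speed2_d1 s t v z) (at 0)"
    and "((\<lambda>\<epsilon>. speed2_d1 s t (\<lambda>x. v x + \<epsilon> *\<^sub>R z x) y) has_real_derivative speed2_d2 s t v y z) (at 0)"
proof -
  note N = has_real_derivative_norm_line[of _ 0, simplified] has_real_derivative_norm_d1_line[of _ 0, simplified]
  note D = N(1)[OF assms(1), of "z s"] N(1)[OF assms(2), of "z t"]
     N(2)[OF assms(1), of "z s" "y s"] N(2)[OF assms(2), of "z t" "y t"]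
  show "((\<lambda>\<epsilon>. norm (v s + \<epsilon> *\<^sub>R z s) * norm (v t + \<epsilon> *\<^sub>R z t)) has_real_derivative speed2_d1 s t v z) (at 0)"
    by (rule DERIV_cong[OF DERIV_mult[OF D(1,2)]]) (simp add: speed2_d1_def)
  show "((\<lambda>\<epsilon>. speed2_d1 s t (\<lambda>x. v x + \<epsilon> *\<^sub>R z x) y) has_real_derivative speed2_d2 s t v y z) (at 0)"
    unfolding speed2_d1_def
    by (rule DERIV_cong[OF DERIV_add[OF DERIV_mult[OF D(3,2)] DERIV_mult[OF D(1,4)]]])
      (simp add: speed2_d2_def)
qed

lemma form_derivatives:
  fixes v y z :: "real \<Rightarrow> 'a::euclidean_space"
  assumes \<alpha>: "0 < \<alpha>" and p: "1 \<le> p" and reg: "regular a b s t v"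
    and y: "continuous_on {a..b} y" and z: "continuous_on {a..b} z"
  shows "((\<lambda>\<epsilon>. form0 \<alpha> p a b s t (\<lambda>x. v x + \<epsilon> *\<^sub>R z x)) has_real_derivative form1 \<alpha> p a b s t v z) (at 0)"
    and "((\<lambda>\<epsilon>. form1 \<alpha> p a b s t (\<lambda>x. v x + \<epsilon> *\<^sub>R z x) y) has_real_derivative form2 \<alpha> p a b s t v y z) (at 0)"
proof -
  have v: "continuous_on {a..b} v" and nz: "\<And>x. x \<in> {a..b} \<Longrightarrow> v x \<noteq> 0" "integral {a..b} v \<noteq> 0"
    and st: "v s \<noteq> 0" "v t \<noteq> 0"
    using reg by (auto simp: regular_def)
  note D = defect_derivatives[OF v z y, where \<alpha> = \<alpha> and e = 0, unfolded scaleR_zero_left add_0_right, OF nz]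
  note Dy = defect_derivatives(1)[OF v y y, where \<alpha> = \<alpha> and e = 0, unfolded scaleR_zero_left add_0_right, OF nz]
  note pos = defect0_nonneg_nearby[OF \<alpha> v _ nz(2)]
  note S = speed2_derivatives[OF st]
  \<comment> \<open>The derivative to be computed runs in the direction \<open>z\<close>, but the
    factor that must vanish is the variation in the direction \<open>y\<close>; hence the minimum is
    considered along \<open>y\<close>.\<close>
  have zero: "defect1 \<alpha> a b v y = 0" if "defect0 \<alpha> a b v = 0"
  proof (rule deriv_zero_of_min[OF Dy pos[OF y]])
    have "(\<lambda>x. v x + 0 *\<^sub>R y x) = v" by simp
    then show "defect0 \<alpha> a b (\<lambda>x. v x + 0 *\<^sub>R y x) = 0" using that by simp
  qed
  note P = has_real_derivative_powr_comp_nonneg[OF p D(1) pos[OF z], simplified]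
  note Q = has_real_derivative_powr_slope_mult[OF p D(1) pos[OF z] D(2), simplified, OF zero]
  show "((\<lambda>\<epsilon>. form0 \<alpha> p a b s t (\<lambda>x. v x + \<epsilon> *\<^sub>R z x)) has_real_derivative form1 \<alpha> p a b s t v z) (at 0)"
    unfolding form0_def
    by (rule DERIV_cong[OF DERIV_mult[OF P S(1)]]) (simp add: form1_def mult.assoc)
  show "((\<lambda>\<epsilon>. form1 \<alpha> p a b s t (\<lambda>x. v x + \<epsilon> *\<^sub>R z x) y) has_real_derivative form2 \<alpha> p a b s t v y z) (at 0)"
    unfolding form1_def
    by (rule DERIV_cong[OF DERIV_add[OF DERIV_mult[OF DERIV_mult[OF DERIV_const Q] S(1)] DERIV_mult[OF P S(2)]]])
      (simp_all add: form2_def mult_ac)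
qed

lemma forms_bound:
  fixes \<alpha> p c M K :: real
  assumes \<alpha>: "0 < \<alpha>" and p: "1 \<le> p" and c: "0 < c"
  obtains C where "\<And>a b s t (v :: real \<Rightarrow> 'a::euclidean_space) y z.
    \<lbrakk>tame c M (K * (b - a) powr (\<alpha> / 2)) a b v y z; (v s, y s, z s) \<in> triples c M;
     (v t, y t, z t) \<in> triples c M\<rbrakk> \<Longrightarrow>
    \<bar>defect0 \<alpha> a b v powr p\<bar> \<le> C \<and> \<bar>form1 \<alpha> p a b s t v y\<bar> \<le> C \<and> \<bar>form2 \<alpha> p a b s t v y z\<bar> \<le> C"
proof -
  obtain C1 where C1: "0 \<le> C1" "\<And>a b (v :: real \<Rightarrow> 'a) y z. tame c M (K * (b - a) powr (\<alpha> / 2)) a b v y z \<Longrightarrow>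
    \<bar>defect0 \<alpha> a b v\<bar> \<le> C1 \<and> \<bar>defect1 \<alpha> a b v y\<bar> \<le> C1 \<and> \<bar>defect2 \<alpha> a b v y z\<bar> \<le> C1"
    using defects_bound[OF c] by blast
  obtain C2 where C2: "0 \<le> C2" "\<And>a b (v :: real \<Rightarrow> 'a) y z. tame c M (K * (b - a) powr (\<alpha> / 2)) a b v y z \<Longrightarrow>
    (defect1 \<alpha> a b v y)\<^sup>2 \<le> C2 * defect0 \<alpha> a b v"
    using defect1_square_bound[OF \<alpha> c] by blast
  define P where "P = C1 powr p"
  define Q where "Q = powr_slope p C1"
  define R where "R = C2 * C1 powr (p - 1)"
  define S where "S = 2 * M * M / c"
  \<comment> \<open>A sum of bounds for the three quantities, the last two copied term by term from
    \<open>form1\<close> and \<open>form2\<close>, so that the triangle and product rules in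
    \<open>intros\<close> match it structurally.\<close>
  define C where "C = P + (p * (Q * C1) * (M * M) + P * (M * M + M * M)) +
     (p * ((p - 1) * R + Q * C1) * (M * M) + p * (Q * C1) * (M * M + M * M)
      + (p * (Q * C1) * (M * M + M * M) + P * (S * M + M * M + (M * M + M * S))))"
  show ?thesis
  proof (rule that[of C])
    fix a b s t and v y z :: "real \<Rightarrow> 'a"
    assume t: "tame c M (K * (b - a) powr (\<alpha> / 2)) a b v y z"
      and vs: "(v s, y s, z s) \<in> triples c M" and vt: "(v t, y t, z t) \<in> triples c M"
    note T = tameD[OF t]
    define X where "X = defect0 \<alpha> a b v"
    define Y where "Y = defect1 \<alpha> a b v y"
    define Z where "Z = defect1 \<alpha> a b v z"
    define W where "W = defect2 \<alpha> a b v y z"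
    have X0: "0 \<le> X" unfolding X_def by (intro defect0_nonneg \<alpha> T tame_nonzero(2)[OF t c])
    have X: "X \<le> C1" "\<bar>Y\<bar> \<le> C1" "\<bar>Z\<bar> \<le> C1" "\<bar>W\<bar> \<le> C1"
      using C1(2)[OF t] C1(2)[OF tame_swap[OF t]] by (auto simp: X_def Y_def Z_def W_def)
    have sq: "Y\<^sup>2 \<le> C2 * X" "Z\<^sup>2 \<le> C2 * X"
      using C2(2)[OF t] C2(2)[OF tame_swap[OF t]] by (auto simp: X_def Y_def Z_def)
    \<comment> \<open>The square bound concerns one direction at a time; the mixed product follows
      from it by the arithmetic-geometric mean inequality.\<close>
    have "2 * (\<bar>Z\<bar> * \<bar>Y\<bar>) \<le> Z\<^sup>2 + Y\<^sup>2" using sum_squares_bound[of "\<bar>Z\<bar>" "\<bar>Y\<bar>"] by simp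
    then have ZY: "\<bar>Z * Y\<bar> \<le> C2 * X" using sq by (simp add: abs_mult)
    have M: "c \<le> M" "0 \<le> M" "0 \<le> S" using vs c by (auto simp: triples_def S_def)
    have P: "\<bar>X powr p\<bar> \<le> P" using X0 X p by (simp add: P_def powr_mono2)
    have Q: "\<bar>powr_slope p X\<bar> \<le> Q" using X0 X p by (simp add: Q_def powr_slope_def powr_mono2)
    \<comment> \<open>One factor \<open>X\<close> turns the singular \<open>X powr (p - 2)\<close>
      into \<open>X powr (p - 1)\<close>, bounded because \<open>p \<ge> 1\<close>. At
      \<open>X = 0\<close> both sides are 0 by the convention for \<open>powr\<close>.\<close>
    have R: "\<bar>X powr (p - 2) * (Z * Y)\<bar> \<le> R"
    proof -
      have "\<bar>X powr (p - 2) * (Z * Y)\<bar> \<le> X powr (p - 2) * (C2 * X)"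
        unfolding abs_mult[of "X powr (p - 2)"] using ZY by (simp add: mult_left_mono)
      also have "\<dots> = C2 * X powr (p - 1)"
        using X0 by (cases "X = 0") (simp_all add: powr_diff power2_eq_square)
      also have "\<dots> \<le> R" unfolding R_def using X0 X p C2(1) by (intro mult_left_mono powr_mono2) auto
      finally show ?thesis .
    qed
    have nz: "v s \<noteq> 0" "v t \<noteq> 0" using vs vt c by (auto simp: triples_def)
    have le: "norm (v s) \<le> M" "norm (v t) \<le> M" "norm (y s) \<le> M" "norm (y t) \<le> M" "norm (z s) \<le> M" "norm (z t) \<le> M"
      "c \<le> norm (v s)" "c \<le> norm (v t)"
      using vs vt by (auto simp: triples_def)
    have d1: "\<bar>norm_d1 (v s) (y s)\<bar> \<le> M" "\<bar>norm_d1 (v t) (y t)\<bar> \<le> M"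
      "\<bar>norm_d1 (v s) (z s)\<bar> \<le> M" "\<bar>norm_d1 (v t) (z t)\<bar> \<le> M"
      using norm_d1_bound[OF nz(1)] norm_d1_bound[OF nz(2)] le order_trans by blast+
    have d2: "\<bar>norm_d2 (v s) (y s) (z s)\<bar> \<le> S" "\<bar>norm_d2 (v t) (y t) (z t)\<bar> \<le> S"
      unfolding S_def using M c
      by (intro order_trans[OF norm_d2_bound[OF nz(1)]] order_trans[OF norm_d2_bound[OF nz(2)]]
          frac_le mult_mono le; simp)+
    have n: "\<bar>norm (v s)\<bar> \<le> M" "\<bar>norm (v t)\<bar> \<le> M" using le by auto
    have pp: "\<bar>p\<bar> \<le> p" "\<bar>p - 1\<bar> \<le> p - 1" using p by auto
    have am: "\<bar>x * x'\<bar> \<le> B * B'" if "\<bar>x\<bar> \<le> B" "\<bar>x'\<bar> \<le> B'" for x x' B B' :: real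
      unfolding abs_mult using that by (intro mult_mono) auto
    have aa: "\<bar>x + x'\<bar> \<le> B + B'" if "\<bar>x\<bar> \<le> B" "\<bar>x'\<bar> \<le> B'" for x x' B B' :: real
      using that by linarith
    note intros = aa am P Q X R d1 d2 n pp
    have f1: "\<bar>form1 \<alpha> p a b s t v y\<bar> \<le> p * (Q * C1) * (M * M) + P * (M * M + M * M)"
      unfolding form1_def speed2_d1_def X_def[symmetric] Y_def[symmetric] by (intro intros)
    have f2: "\<bar>form2 \<alpha> p a b s t v y z\<bar> \<le> p * ((p - 1) * R + Q * C1) * (M * M) + p * (Q * C1) * (M * M + M * M)
      + (p * (Q * C1) * (M * M + M * M) + P * (S * M + M * M + (M * M + M * S)))"
      unfolding form2_def speed2_d1_def speed2_d2_def X_def[symmetric] Y_def[symmetric] Z_def[symmetric]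
        W_def[symmetric] mult.assoc[of "p - 1"] mult.assoc[of "X powr (p - 2)"]
      by (intro intros)
    have "0 \<le> P" "\<bar>form1 \<alpha> p a b s t v y\<bar> \<ge> 0" "\<bar>form2 \<alpha> p a b s t v y z\<bar> \<ge> 0" by (auto simp: P_def)
    then show "\<bar>defect0 \<alpha> a b v powr p\<bar> \<le> C \<and> \<bar>form1 \<alpha> p a b s t v y\<bar> \<le> C \<and> \<bar>form2 \<alpha> p a b s t v y z\<bar> \<le> C"
      using P f1 f2 unfolding C_def X_def[symmetric] by linarith
  qed
qed

section \<open>Variations of closed curves\<close>

definition velocity :: "(real \<Rightarrow> 'a::real_normed_vector) \<Rightarrow> real \<Rightarrow> 'a" where
  "velocity g x = vector_derivative g (at x)"

definition closed_C1 :: "real \<Rightarrow> (real \<Rightarrow> 'a::real_normed_vector) \<Rightarrow> bool" where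
  "closed_C1 L g \<longleftrightarrow> periodic_fun_simple g L \<and>
     (\<forall>x. (g has_vector_derivative velocity g x) (at x)) \<and> continuous_on UNIV (velocity g)"

lemma closed_C1I:
  assumes "periodic_fun_simple g L" "g C1_differentiable_on UNIV"
  shows "closed_C1 L g"
  using assms unfolding closed_C1_def C1_differentiable_on_eq velocity_def vector_derivative_works by auto

lemma closed_C1_perturb:
  assumes "closed_C1 L g" "closed_C1 L u"
  shows "closed_C1 L (\<lambda>s. g s + \<epsilon> *\<^sub>R u s)"
    "velocity (\<lambda>s. g s + \<epsilon> *\<^sub>R u s) = (\<lambda>x. velocity g x + \<epsilon> *\<^sub>R velocity u x)"
proof -
  have d: "((\<lambda>s. g s + \<epsilon> *\<^sub>R u s) has_vector_derivative velocity g x + \<epsilon> *\<^sub>R velocity u x) (at x)" for x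
    using assms unfolding closed_C1_def by (auto intro!: derivative_eq_intros)
  show v: "velocity (\<lambda>s. g s + \<epsilon> *\<^sub>R u s) = (\<lambda>x. velocity g x + \<epsilon> *\<^sub>R velocity u x)"
    unfolding velocity_def[of "\<lambda>s. g s + \<epsilon> *\<^sub>R u s"] using vector_derivative_at[OF d] by blast
  have "periodic_fun_simple (\<lambda>s. g s + \<epsilon> *\<^sub>R u s) L"
    using assms by (auto simp: closed_C1_def periodic_fun_simple_def)
  moreover have "continuous_on UNIV (\<lambda>x. velocity g x + \<epsilon> *\<^sub>R velocity u x)"
    using assms by (intro continuous_intros) (auto simp: closed_C1_def)
  ultimately show "closed_C1 L (\<lambda>s. g s + \<epsilon> *\<^sub>R u s)" using d by (simp add: closed_C1_def v)
qed

section \<open>The two arcs between a pair of parameters\<close>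

definition lift_end :: "real \<Rightarrow> real \<Rightarrow> real \<Rightarrow> real" where
  "lift_end L s t = (if s \<le> t then t else t + L)"

text \<open>Shorter and longer refer to lengths in the parameter, that is, to the unvaried arclength
  curve; the same intervals are kept for its variations. For \<open>s\<close> and \<open>t\<close>
  in \<open>{0..<L}\<close> they lie in \<open>{0..2 * L}\<close>, so bounds on that interval
  suffice.\<close>

definition short_lo :: "real \<Rightarrow> real \<Rightarrow> real \<Rightarrow> real" where
  "short_lo L s t = (if lift_end L s t - s < L / 2 then s else lift_end L s t)"

definition short_hi :: "real \<Rightarrow> real \<Rightarrow> real \<Rightarrow> real" where
  "short_hi L s t = (if lift_end L s t - s < L / 2 then lift_end L s t else s + L)"

definition long_lo :: "real \<Rightarrow> real \<Rightarrow> real \<Rightarrow> real" where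
  "long_lo L s t = (if lift_end L s t - s < L / 2 then lift_end L s t else s)"

definition long_hi :: "real \<Rightarrow> real \<Rightarrow> real \<Rightarrow> real" where
  "long_hi L s t = (if lift_end L s t - s < L / 2 then s + L else lift_end L s t)"

lemmas arc_ends = lift_end_def short_lo_def short_hi_def long_lo_def long_hi_def

text \<open>
  If \<open>\<bar>s - t\<bar> = L / 2\<close>, both arcs have the same length and the intrinsic distance of the varied curves
  need not be differentiable; these pairs form a null set.
\<close>

definition generic :: "real \<Rightarrow> real \<Rightarrow> real \<Rightarrow> bool" where
  "generic L s t \<longleftrightarrow> s \<in> {0..<L} \<and> t \<in> {0..<L} \<and> s \<noteq> t \<and> \<bar>s - t\<bar> \<noteq> L / 2"

lemma lift_end_rmod:
  assumes "s \<in> {0..<L}" "t \<in> {0..<L}"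
  shows "s + (t - s) rmod L = lift_end L s t"
proof (cases "s \<le> t")
  case True
  then have "(t - s) rmod L = t - s" using assms by (intro rmod_idem) auto
  then show ?thesis using True by (simp add: lift_end_def)
next
  case False
  have "(t - s) rmod L = t - s + L"
    by (rule rmod_unique[of _ _ _ "- 1"]) (use False assms in auto)
  then show ?thesis using False by (simp add: lift_end_def)
qed

lemma short_arc_bounds:
  assumes "s \<in> {0..<L}" "t \<in> {0..<L}"
  shows "0 \<le> short_lo L s t" "short_lo L s t \<le> short_hi L s t" "short_hi L s t \<le> 2 * L"
  using assms by (auto simp: arc_ends)

lemma generic_arc_bounds:
  assumes "generic L s t"
  shows "short_lo L s t < short_hi L s t" "short_hi L s t - short_lo L s t < L / 2"
    "0 \<le> long_lo L s t" "long_lo L s t \<le> long_hi L s t" "long_hi L s t \<le> 2 * L"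
    "long_hi L s t - long_lo L s t = L - (short_hi L s t - short_lo L s t)"
  using assms by (auto simp: arc_ends generic_def abs_if split: if_splits)

lemma intrinsic_dist_arcs:
  assumes "s \<in> {0..<L}" "t \<in> {0..<L}"
  shows "intrinsic_dist L g s t =
    min (arc_length g (short_lo L s t) (short_hi L s t)) (arc_length g (long_lo L s t) (long_hi L s t))"
  unfolding intrinsic_dist_def Let_def lift_end_rmod[OF assms]
  by (simp add: short_lo_def short_hi_def long_lo_def long_hi_def min.commute)

text \<open>Up to a period, the ends of the arc are \<open>s\<close> and \<open>t\<close> in one
  order or the other, and the norm does not see the order.\<close>

lemma integral_velocity_short_arc:
  fixes g :: "real \<Rightarrow> 'a::euclidean_space"
  assumes "closed_C1 L g" "s \<in> {0..<L}" "t \<in> {0..<L}"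
  shows "norm (integral {short_lo L s t..short_hi L s t} (velocity g)) = norm (g s - g t)"
proof -
  have "(velocity g has_integral g (short_hi L s t) - g (short_lo L s t)) {short_lo L s t..short_hi L s t}"
    using assms by (intro fundamental_theorem_of_calculus short_arc_bounds)
      (auto simp: closed_C1_def intro: has_vector_derivative_at_within)
  then have "integral {short_lo L s t..short_hi L s t} (velocity g) = g (short_hi L s t) - g (short_lo L s t)"
    by (rule integral_unique)
  moreover have "g (x + L) = g x" for x
    using assms(1) by (simp add: closed_C1_def periodic_fun_simple_def)
  ultimately show ?thesis by (auto simp: arc_ends norm_minus_commute)
qed

definition near_unit :: "real \<Rightarrow> real \<Rightarrow> (real \<Rightarrow> 'a::real_normed_vector) \<Rightarrow> bool" where
  "near_unit L \<eta> v \<longleftrightarrow> (\<forall>x\<in>{0..2 * L}. \<bar>norm (v x) - 1\<bar> \<le> \<eta>)"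

lemma integral_norm_near_unit:
  fixes v :: "real \<Rightarrow> 'a::euclidean_space"
  assumes "near_unit L \<eta> v" "continuous_on UNIV v" "0 \<le> a" "a \<le> b" "b \<le> 2 * L"
  shows "\<bar>integral {a..b} (\<lambda>x. norm (v x)) - (b - a)\<bar> \<le> \<eta> * (b - a)"
proof -
  have c: "continuous_on {a..b} (\<lambda>x. norm (v x))"
    using assms(2) by (intro continuous_intros) (rule continuous_on_subset, auto)
  have "norm (integral {a..b} (\<lambda>x. norm (v x) - 1)) \<le> \<eta> * (b - a)"
    using assms by (intro integral_bound continuous_intros c) (auto simp: near_unit_def)
  then show ?thesis using assms(4)
    by (simp add: Henstock_Kurzweil_Integration.integral_diff integrable_continuous_real c)
qed

text \<open>With \<open>d\<close> the parameter length, the first arc has length at most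
  \<open>(1 + \<eta>) * d\<close> and the other at least \<open>(1 - \<eta>) * (L - d)\<close>. The
  former is at most the latter exactly when \<open>\<eta> * L \<le> L - 2 * d\<close>.\<close>

lemma intrinsic_dist_near_unit:
  fixes g :: "real \<Rightarrow> 'a::euclidean_space"
  assumes g: "generic L s t" and cont: "continuous_on UNIV (velocity g)"
    and near: "near_unit L \<eta> (velocity g)"
    and \<eta>: "\<eta> * L \<le> L - 2 * (short_hi L s t - short_lo L s t)"
  shows "intrinsic_dist L g s t = integral {short_lo L s t..short_hi L s t} (\<lambda>x. norm (velocity g x))"
proof -
  have st: "s \<in> {0..<L}" "t \<in> {0..<L}" using g by (auto simp: generic_def)
  define d where "d = short_hi L s t - short_lo L s t"
  have al: "arc_length g a b = integral {a..b} (\<lambda>x. norm (velocity g x))" for a b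
    by (simp add: arc_length_def velocity_def)
  have S: "\<bar>arc_length g (short_lo L s t) (short_hi L s t) - d\<bar> \<le> \<eta> * d"
    unfolding al d_def by (intro integral_norm_near_unit[OF near cont] short_arc_bounds st)
  have "\<bar>arc_length g (long_lo L s t) (long_hi L s t) - (long_hi L s t - long_lo L s t)\<bar>
     \<le> \<eta> * (long_hi L s t - long_lo L s t)"
    unfolding al by (intro integral_norm_near_unit[OF near cont] generic_arc_bounds g)
  then have "\<bar>arc_length g (long_lo L s t) (long_hi L s t) - (L - d)\<bar> \<le> \<eta> * (L - d)"
    unfolding generic_arc_bounds(6)[OF g] d_def .
  then have "arc_length g (short_lo L s t) (short_hi L s t) \<le> arc_length g (long_lo L s t) (long_hi L s t)"
    using S \<eta> unfolding d_def[symmetric] right_diff_distrib by linarith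
  then show ?thesis unfolding intrinsic_dist_arcs[OF st] al by simp
qed

text \<open>
  A property stable under small variations which ensures that the arc over
  \<open>[short_lo L s t, short_hi L s t]\<close> stays the shorter one.
\<close>

definition good :: "real \<Rightarrow> real \<Rightarrow> real \<Rightarrow> (real \<Rightarrow> 'a::euclidean_space) \<Rightarrow> bool" where
  "good L s t v \<longleftrightarrow> continuous_on UNIV v \<and>
     (\<exists>\<eta>. near_unit L \<eta> v \<and> \<eta> * L < L - 2 * (short_hi L s t - short_lo L s t)) \<and>
     integral {short_lo L s t..short_hi L s t} v \<noteq> 0"

lemma good_regular:
  assumes "0 < L" "generic L s t" "good L s t v"
  shows "regular (short_lo L s t) (short_hi L s t) s t v"
proof -
  obtain \<eta> where \<eta>: "near_unit L \<eta> v" "\<eta> * L < L - 2 * (short_hi L s t - short_lo L s t)"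
    using assms(3) by (auto simp: good_def)
  \<comment> \<open>A short arc of positive parameter length forces \<open>\<eta> < 1\<close>, so
    the speed cannot vanish anywhere on \<open>{0..2 * L}\<close>.\<close>
  have "0 < 2 * (short_hi L s t - short_lo L s t)" using generic_arc_bounds(1)[OF assms(2)] by simp
  then have "\<eta> * L < L" using \<eta>(2) by simp
  then have "\<eta> < 1" using assms(1) by simp
  then have nz: "v x \<noteq> 0" if "x \<in> {0..2 * L}" for x using \<eta>(1) that by (force simp: near_unit_def)
  have st: "s \<in> {0..<L}" "t \<in> {0..<L}" using assms(2) by (auto simp: generic_def)
  have "continuous_on {short_lo L s t..short_hi L s t} v"
    using assms(3) by (auto simp: good_def intro: continuous_on_subset)
  then show ?thesis using assms(3) nz short_arc_bounds[OF st] st by (auto simp: regular_def good_def)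
qed

text \<open>The strict inequality in \<open>good\<close> leaves room to enlarge
  \<open>\<eta>\<close> by \<open>\<bar>\<epsilon>\<bar> * B\<close>, where \<open>B\<close> bounds
  the variation. The neighbourhood depends on the pair, which is harmless: it serves only to compute
  derivatives at that pair.\<close>

lemma good_nearby:
  fixes v z :: "real \<Rightarrow> 'a::euclidean_space"
  assumes L: "0 < L" and v: "good L s t v" and z: "continuous_on UNIV z"
  shows "\<forall>\<^sub>F \<epsilon> in nhds 0. good L s t (\<lambda>x. v x + \<epsilon> *\<^sub>R z x)"
proof -
  define a where "a = short_lo L s t"
  define b where "b = short_hi L s t"
  obtain \<eta> where \<eta>: "near_unit L \<eta> v" "\<eta> * L < L - 2 * (b - a)"
    using v by (auto simp: good_def a_def b_def)
  have cv: "continuous_on UNIV v" and nz: "integral {a..b} v \<noteq> 0" using v by (auto simp: good_def a_def b_def)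
  have cab: "continuous_on {a..b} v" "continuous_on {a..b} z"
    using cv z by (auto intro: continuous_on_subset)
  have I: "integral {a..b} (\<lambda>x. v x + \<epsilon> *\<^sub>R z x) = integral {a..b} v + \<epsilon> *\<^sub>R integral {a..b} z" for \<epsilon>
    by (simp add: Henstock_Kurzweil_Integration.integral_add integrable_continuous_real
        continuous_intros cab)
  have "((\<lambda>\<epsilon>. integral {a..b} v + \<epsilon> *\<^sub>R integral {a..b} z) \<longlongrightarrow> integral {a..b} v + 0 *\<^sub>R integral {a..b} z) (nhds 0)"
    by (intro tendsto_intros filterlim_ident)
  then have ev1: "\<forall>\<^sub>F \<epsilon> in nhds 0. integral {a..b} v + \<epsilon> *\<^sub>R integral {a..b} z \<noteq> 0"
    by (rule tendsto_imp_eventually_ne) (use nz in simp)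
  have "bounded (z ` {0..2 * L})"
    by (intro compact_imp_bounded compact_continuous_image continuous_on_subset[OF z]) auto
  then obtain B where B: "\<And>x. x \<in> {0..2 * L} \<Longrightarrow> norm (z x) \<le> B"
    unfolding bounded_iff by blast
  have "((\<lambda>\<epsilon>. (\<eta> + \<bar>\<epsilon>\<bar> * B) * L) \<longlongrightarrow> (\<eta> + \<bar>0\<bar> * B) * L) (nhds 0)"
    by (intro tendsto_intros filterlim_ident)
  then have ev2: "\<forall>\<^sub>F \<epsilon> in nhds 0. (\<eta> + \<bar>\<epsilon>\<bar> * B) * L < L - 2 * (b - a)"
    by (rule order_tendstoD) (use \<eta> in simp)
  show ?thesis using ev1 ev2
  proof eventually_elim
    case (elim \<epsilon>)
    have "near_unit L (\<eta> + \<bar>\<epsilon>\<bar> * B) (\<lambda>x. v x + \<epsilon> *\<^sub>R z x)"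
      unfolding near_unit_def
    proof
      fix x assume x: "x \<in> {0..2 * L}"
      have "norm (\<epsilon> *\<^sub>R z x) \<le> \<bar>\<epsilon>\<bar> * B" using B[OF x] by (simp add: mult_left_mono)
      then show "\<bar>norm (v x + \<epsilon> *\<^sub>R z x) - 1\<bar> \<le> \<eta> + \<bar>\<epsilon>\<bar> * B"
        using norm_triangle_ineq3[of "v x + \<epsilon> *\<^sub>R z x" "v x"] \<eta>(1) x unfolding near_unit_def by force
    qed
    moreover have "continuous_on UNIV (\<lambda>x. v x + \<epsilon> *\<^sub>R z x)" by (intro continuous_intros cv z)
    ultimately show ?case using elim I unfolding good_def a_def[symmetric] b_def[symmetric] by auto
  qed
qed

section \<open>Energy form and variations at generic pairs\<close>

lemma energy_density_good:
  fixes g :: "real \<Rightarrow> 'a::euclidean_space"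
  assumes "generic L s t" "closed_C1 L g" "good L s t (velocity g)"
  shows "energy_density L \<alpha> p g s t = defect0 \<alpha> (short_lo L s t) (short_hi L s t) (velocity g) powr p"
proof -
  obtain \<eta> where \<eta>: "near_unit L \<eta> (velocity g)" "\<eta> * L < L - 2 * (short_hi L s t - short_lo L s t)"
    using assms(3) by (auto simp: good_def)
  have st: "s \<in> {0..<L}" "t \<in> {0..<L}" using assms(1) by (auto simp: generic_def)
  have "continuous_on UNIV (velocity g)" using assms(3) by (simp add: good_def)
  note dist = intrinsic_dist_near_unit[OF assms(1) this \<eta>(1) less_imp_le[OF \<eta>(2)]]
  show ?thesis
    unfolding energy_density_def defect0_def dist integral_velocity_short_arc[OF assms(2) st]
    by (simp add: powr_minus_divide)
qed

lemma energy_form_good: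
  fixes g :: "real \<Rightarrow> 'a::euclidean_space"
  assumes "generic L s t" "closed_C1 L g" "good L s t (velocity g)"
  shows "energy_form L \<alpha> p g s t = form0 \<alpha> p (short_lo L s t) (short_hi L s t) s t (velocity g)"
  using energy_density_good[OF assms] by (simp add: energy_form_def form0_def velocity_def)

lemma energy_form_has_derivative:
  fixes g u :: "real \<Rightarrow> 'a::euclidean_space"
  assumes L: "0 < L" and \<alpha>: "0 < \<alpha>" and p: "1 \<le> p" and gen: "generic L s t"
    and g: "closed_C1 L g" "good L s t (velocity g)" and u: "closed_C1 L u"
  shows "((\<lambda>\<epsilon>. energy_form L \<alpha> p (\<lambda>x. g x + \<epsilon> *\<^sub>R u x) s t) has_real_derivative
     form1 \<alpha> p (short_lo L s t) (short_hi L s t) s t (velocity g) (velocity u)) (at 0)"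
proof -
  have cu: "continuous_on UNIV (velocity u)" using u by (simp add: closed_C1_def)
  have "\<forall>\<^sub>F \<epsilon> in nhds 0. energy_form L \<alpha> p (\<lambda>x. g x + \<epsilon> *\<^sub>R u x) s t
      = form0 \<alpha> p (short_lo L s t) (short_hi L s t) s t (\<lambda>x. velocity g x + \<epsilon> *\<^sub>R velocity u x)"
    using good_nearby[OF L g(2) cu]
  proof eventually_elim
    case (elim \<epsilon>)
    show ?case
      using energy_form_good[OF gen closed_C1_perturb(1)[OF g(1) u]] elim
      by (simp add: closed_C1_perturb(2)[OF g(1) u])
  qed
  note ev = this
  have cab: "continuous_on {short_lo L s t..short_hi L s t} (velocity u)"
    by (rule continuous_on_subset[OF cu]) auto
  show ?thesis
    using form_derivatives(1)[OF \<alpha> p good_regular[OF L gen g(2)] cab cab]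
    by (subst DERIV_cong_ev[OF refl ev refl])
qed

text \<open>The inner derivative of the second variation is needed at all curves near
  \<open>f\<close>, not only at \<open>f\<close>; therefore \<open>fve\<close> and \<open>fv\<close>
  are proved for every good \<open>g\<close>. As \<psi> is varied first, it comes before \<phi> in
  \<open>form2\<close>.\<close>

lemma energy_variations:
  fixes f \<phi> \<psi> :: "real \<Rightarrow> 'a::euclidean_space"
  assumes L: "0 < L" and \<alpha>: "0 < \<alpha>" and p: "1 \<le> p" and gen: "generic L s t"
    and f: "closed_C1 L f" "good L s t (velocity f)" and \<phi>: "closed_C1 L \<phi>" and \<psi>: "closed_C1 L \<psi>"
  defines "a \<equiv> short_lo L s t" and "b \<equiv> short_hi L s t"
  shows "first_variation_exists (\<lambda>g. energy_form L \<alpha> p g s t) f \<phi>"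
    "energy_G L \<alpha> p f \<phi> s t = form1 \<alpha> p a b s t (velocity f) (velocity \<phi>)"
    "second_variation_exists (\<lambda>g. energy_form L \<alpha> p g s t) f \<phi> \<psi>"
    "energy_H L \<alpha> p f \<phi> \<psi> s t = form2 \<alpha> p a b s t (velocity f) (velocity \<psi>) (velocity \<phi>)"
proof -
  note D = energy_form_has_derivative[OF L \<alpha> p gen]
  have fve: "first_variation_exists (\<lambda>g. energy_form L \<alpha> p g s t) g u"
    if "closed_C1 L g" "good L s t (velocity g)" "closed_C1 L u" for g u :: "real \<Rightarrow> 'a"
    unfolding first_variation_exists_def using D[OF that] real_differentiable_def by blast
  have fv: "first_variation (\<lambda>g. energy_form L \<alpha> p g s t) g u = form1 \<alpha> p a b s t (velocity g) (velocity u)"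
    if "closed_C1 L g" "good L s t (velocity g)" "closed_C1 L u" for g u :: "real \<Rightarrow> 'a"
    unfolding first_variation_def a_def b_def by (rule DERIV_imp_deriv[OF D[OF that]])
  show "first_variation_exists (\<lambda>g. energy_form L \<alpha> p g s t) f \<phi>" by (rule fve[OF f \<phi>])
  show "energy_G L \<alpha> p f \<phi> s t = form1 \<alpha> p a b s t (velocity f) (velocity \<phi>)"
    unfolding energy_G_def by (rule fv[OF f \<phi>])
  have c: "continuous_on UNIV (velocity \<phi>)" "continuous_on UNIV (velocity \<psi>)"
    using \<phi> \<psi> by (simp_all add: closed_C1_def)
  have cab: "continuous_on {a..b} (velocity \<phi>)" "continuous_on {a..b} (velocity \<psi>)"
    by (rule continuous_on_subset[OF c(1)] continuous_on_subset[OF c(2)]; simp)+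
  note P = closed_C1_perturb[OF f(1) \<phi>]
  note ev = good_nearby[OF L f(2) c(1)]
  have ev1: "\<forall>\<^sub>F \<epsilon> in nhds 0. first_variation_exists (\<lambda>g. energy_form L \<alpha> p g s t) (\<lambda>s. f s + \<epsilon> *\<^sub>R \<phi> s) \<psi>"
    using ev by eventually_elim (rule fve[OF P(1) _ \<psi>], simp add: P(2))
  have ev2: "\<forall>\<^sub>F \<epsilon> in nhds 0. first_variation (\<lambda>g. energy_form L \<alpha> p g s t) (\<lambda>s. f s + \<epsilon> *\<^sub>R \<phi> s) \<psi>
      = form1 \<alpha> p a b s t (\<lambda>x. velocity f x + \<epsilon> *\<^sub>R velocity \<phi> x) (velocity \<psi>)"
    using ev by eventually_elim (subst fv[OF P(1) _ \<psi>], simp_all add: P(2))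
  have D2: "((\<lambda>\<epsilon>. first_variation (\<lambda>g. energy_form L \<alpha> p g s t) (\<lambda>s. f s + \<epsilon> *\<^sub>R \<phi> s) \<psi>) has_real_derivative
      form2 \<alpha> p a b s t (velocity f) (velocity \<psi>) (velocity \<phi>)) (at 0)"
    using form_derivatives(2)[OF \<alpha> p good_regular[OF L gen f(2)] cab(2,1)[unfolded a_def b_def]]
    unfolding a_def[symmetric] b_def[symmetric]
    by (subst DERIV_cong_ev[OF refl ev2 refl])
  show "second_variation_exists (\<lambda>g. energy_form L \<alpha> p g s t) f \<phi> \<psi>"
    unfolding second_variation_exists_def first_variation_exists_def[of "\<lambda>g. first_variation _ g _"]
    using ev1 D2 real_differentiable_def by blast
  show "energy_H L \<alpha> p f \<phi> \<psi> s t = form2 \<alpha> p a b s t (velocity f) (velocity \<psi>) (velocity \<phi>)"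
    unfolding energy_H_def second_variation_def first_variation_def[of "\<lambda>g. first_variation _ g _"]
    by (rule DERIV_imp_deriv[OF D2])
qed

section \<open>Boundedness and measurability\<close>

lemma circle_dist_bounds: "0 \<le> circle_dist L s t" "circle_dist L s t \<le> \<bar>s - t\<bar>"
proof -
  show "0 \<le> circle_dist L s t" unfolding circle_dist_def by (rule cINF_greatest) auto
  have "bdd_below (range (\<lambda>k::int. \<bar>s - t + of_int k * L\<bar>))" by (rule bdd_belowI[of _ 0]) auto
  then show "circle_dist L s t \<le> \<bar>s - t\<bar>"
    unfolding circle_dist_def using cINF_lower[of "\<lambda>k::int. \<bar>s - t + of_int k * L\<bar>" UNIV 0] by simp
qed

lemma C1_holder_velocity:
  assumes "C1_holder L \<beta> u" "0 \<le> \<beta>"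
  obtains K where "0 \<le> K" "\<And>x x'. norm (velocity u x - velocity u x') \<le> K * \<bar>x - x'\<bar> powr \<beta>"
proof -
  obtain C where C: "\<And>s t. norm (velocity u s - velocity u t) \<le> C * circle_dist L s t powr \<beta>"
    using assms(1) by (auto simp: C1_holder_def velocity_def)
  show ?thesis
  \<comment> \<open>\<open>C\<close> carries no sign condition, but replacing the circle distance by
    the larger \<open>\<bar>x - x'\<bar>\<close> needs a nonnegative factor.\<close>
  proof (rule that[of "\<bar>C\<bar>"])
    fix x x'
    have "norm (velocity u x - velocity u x') \<le> C * circle_dist L x x' powr \<beta>" by (rule C)
    also have "\<dots> \<le> \<bar>C\<bar> * \<bar>x - x'\<bar> powr \<beta>"
      using circle_dist_bounds[of L x x'] assms(2) by (intro mult_mono powr_mono2) auto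
    finally show "norm (velocity u x - velocity u x') \<le> \<bar>C\<bar> * \<bar>x - x'\<bar> powr \<beta>" .
  qed simp
qed

lemma C1_holder_closed_C1: "C1_holder L \<beta> u \<Longrightarrow> closed_C1 L u"
  by (auto simp: C1_holder_def intro: closed_C1I)

lemma velocity_bounded:
  fixes u :: "real \<Rightarrow> 'a::euclidean_space"
  assumes "closed_C1 L u"
  obtains B where "0 \<le> B" "\<And>x. x \<in> {0..2 * L} \<Longrightarrow> norm (velocity u x) \<le> B"
proof -
  have "continuous_on {0..2 * L} (velocity u)"
    using assms by (auto simp: closed_C1_def intro: continuous_on_subset)
  then have "bounded (velocity u ` {0..2 * L})" by (intro compact_imp_bounded compact_continuous_image) auto
  then show ?thesis using that unfolding bounded_pos by (metis image_eqI less_imp_le)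
qed

text \<open>At unit speed the intrinsic distance of a generic pair is \<open>b - a\<close>, and the
  chord is \<open>b - a\<close> times the norm of the mean velocity. Dividing the bi-Lipschitz
  inequality by \<open>b - a\<close> bounds that norm below by \<open>1 / C\<close>, uniformly in
  the pair.\<close>

lemma bi_lipschitz_tame:
  fixes f \<phi> \<psi> :: "real \<Rightarrow> 'a::euclidean_space"
  assumes L: "0 < L" and \<alpha>: "0 < \<alpha>" and f: "arclength_parametrization L f" and bl: "bi_lipschitz L f"
    and hf: "C1_holder L (\<alpha> / 2) f" and h\<phi>: "C1_holder L (\<alpha> / 2) \<phi>" and h\<psi>: "C1_holder L (\<alpha> / 2) \<psi>"
  obtains c M K where "0 < c"
    "\<And>s t. generic L s t \<Longrightarrow> good L s t (velocity f) \<and>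
       tame c M (K * (short_hi L s t - short_lo L s t) powr (\<alpha> / 2)) (short_lo L s t) (short_hi L s t)
         (velocity f) (velocity \<psi>) (velocity \<phi>) \<and>
       (velocity f s, velocity \<psi> s, velocity \<phi> s) \<in> triples c M \<and>
       (velocity f t, velocity \<psi> t, velocity \<phi> t) \<in> triples c M"
proof -
  have \<beta>: "0 \<le> \<alpha> / 2" using \<alpha> by simp
  note closed = hf[THEN C1_holder_closed_C1] h\<phi>[THEN C1_holder_closed_C1] h\<psi>[THEN C1_holder_closed_C1]
  have cont: "continuous_on UNIV (velocity f)" "continuous_on UNIV (velocity \<phi>)" "continuous_on UNIV (velocity \<psi>)"
    using closed by (simp_all add: closed_C1_def)
  have unit: "norm (velocity f x) = 1" for x
    using f by (simp add: arclength_parametrization_def velocity_def)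
  obtain K1 where K1: "0 \<le> K1" "\<And>x x'. norm (velocity f x - velocity f x') \<le> K1 * \<bar>x - x'\<bar> powr (\<alpha> / 2)"
    using C1_holder_velocity[OF hf \<beta>] by blast
  obtain K2 where K2: "0 \<le> K2" "\<And>x x'. norm (velocity \<phi> x - velocity \<phi> x') \<le> K2 * \<bar>x - x'\<bar> powr (\<alpha> / 2)"
    using C1_holder_velocity[OF h\<phi> \<beta>] by blast
  obtain K3 where K3: "0 \<le> K3" "\<And>x x'. norm (velocity \<psi> x - velocity \<psi> x') \<le> K3 * \<bar>x - x'\<bar> powr (\<alpha> / 2)"
    using C1_holder_velocity[OF h\<psi> \<beta>] by blast
  obtain B2 where B2: "0 \<le> B2" "\<And>x. x \<in> {0..2 * L} \<Longrightarrow> norm (velocity \<phi> x) \<le> B2"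
    using velocity_bounded[OF closed(2)] by blast
  obtain B3 where B3: "0 \<le> B3" "\<And>x. x \<in> {0..2 * L} \<Longrightarrow> norm (velocity \<psi> x) \<le> B3"
    using velocity_bounded[OF closed(3)] by blast
  obtain C where C: "0 < C" "\<And>s t. intrinsic_dist L f s t \<le> C * norm (f s - f t)"
    using bl by (auto simp: bi_lipschitz_def)
  \<comment> \<open>The 1 is for the speed at single points, the \<open>1 / C\<close> for the mean
    velocity.\<close>
  define c where "c = min 1 (1 / C)"
  define M where "M = 1 + B2 + B3"
  define K where "K = K1 + K2 + K3"
  have c: "0 < c" "c \<le> 1" "c \<le> 1 / C" using C(1) by (auto simp: c_def)
  have tri: "(velocity f x, velocity \<psi> x, velocity \<phi> x) \<in> triples c M" if "x \<in> {0..2 * L}" for x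
    using B2(1) B2(2)[OF that] B3(1) B3(2)[OF that] c(2) by (auto simp: triples_def M_def unit)
  show ?thesis
  proof (rule that[OF c(1)], intro conjI)
    fix s t assume gen: "generic L s t"
    have st: "s \<in> {0..<L}" "t \<in> {0..<L}" using gen by (auto simp: generic_def)
    define a where "a = short_lo L s t"
    define b where "b = short_hi L s t"
    have ab: "a < b" "b - a < L / 2" "0 \<le> a" "b \<le> 2 * L"
      using generic_arc_bounds(1,2)[OF gen] short_arc_bounds(1,3)[OF st] by (auto simp: a_def b_def)
    have near: "near_unit L 0 (velocity f)" by (simp add: near_unit_def unit)
    have d: "intrinsic_dist L f s t = b - a"
      using intrinsic_dist_near_unit[OF gen cont(1) near] ab by (simp add: unit a_def b_def)
    have "b - a \<le> C * norm (integral {a..b} (velocity f))"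
      using C(2)[of s t] d integral_velocity_short_arc[OF closed(1) st] by (simp add: a_def b_def)
    also have "\<dots> = (b - a) * (C * norm (avg a b (velocity f)))"
      using ab by (subst integral_eq_avg) auto
    finally have "1 \<le> C * norm (avg a b (velocity f))" using ab(1) by simp
    then have "1 / C \<le> norm (avg a b (velocity f))" using C(1) by (simp add: field_simps)
    then have avg: "c \<le> norm (avg a b (velocity f))" using c by linarith
    then have "integral {a..b} (velocity f) \<noteq> 0" using c(1) by (auto simp: avg_def)
    then show "good L s t (velocity f)"
      using cont near ab unfolding good_def a_def b_def by (intro conjI exI[of _ 0]) auto
    have osc: "norm (velocity u x - velocity u x') \<le> K * (b - a) powr (\<alpha> / 2)"
      if "x \<in> {a..b}" "x' \<in> {a..b}" "0 \<le> k" "k \<le> K"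
        "\<And>x x'. norm (velocity u x - velocity u x') \<le> k * \<bar>x - x'\<bar> powr (\<alpha> / 2)"
      for u :: "real \<Rightarrow> 'a" and x x' k
    proof -
      have "k * \<bar>x - x'\<bar> powr (\<alpha> / 2) \<le> K * (b - a) powr (\<alpha> / 2)"
        using that \<beta> by (intro mult_mono powr_mono2) auto
      then show ?thesis using that(5)[of x x'] by linarith
    qed
    have k: "K1 \<le> K" "K2 \<le> K" "K3 \<le> K" using K1(1) K2(1) K3(1) by (auto simp: K_def)
    show "tame c M (K * (short_hi L s t - short_lo L s t) powr (\<alpha> / 2)) (short_lo L s t) (short_hi L s t)
         (velocity f) (velocity \<psi>) (velocity \<phi>)"
      unfolding tame_def a_def[symmetric] b_def[symmetric]
      by (intro conjI ballI tri ab avg cont[THEN continuous_on_subset] osc[OF _ _ K1(1) k(1) K1(2)]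
          osc[OF _ _ K2(1) k(2) K2(2)] osc[OF _ _ K3(1) k(3) K3(2)]) (use ab in auto)
    show "(velocity f s, velocity \<psi> s, velocity \<phi> s) \<in> triples c M"
      "(velocity f t, velocity \<psi> t, velocity \<phi> t) \<in> triples c M"
      using st L by (intro tri; auto)+
  qed
qed

section \<open>Null sets and measurability on the torus\<close>

lemma fundamental_domain_lebesgue: "{0..<L::real} \<times> {0..<L} \<in> sets lebesgue"
  by (intro sets_completionI_sets) (simp add: borel_Times)

lemma AE_torus_iff:
  "(AE x in torus_measure L. P x) \<longleftrightarrow> (AE x in lebesgue. x \<in> {0..<L} \<times> {0..<L} \<longrightarrow> P x)"
  unfolding torus_measure_def by (rule AE_restrict_space_iff) (simp add: fundamental_domain_lebesgue)

text \<open>The exceptional pairs lie on the three lines where \<open>s - t\<close> is 0,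
  \<open>L / 2\<close> or \<open>- (L / 2)\<close>.\<close>

lemma AE_torus_generic: "AE x in torus_measure L. generic L (fst x) (snd x)"
proof -
  define H where "H b = {x :: real \<times> real. (1, - 1) \<bullet> x = b}" for b
  have "negligible (H 0 \<union> H (L / 2) \<union> H (- (L / 2)))"
    unfolding H_def by (intro negligible_Un negligible_hyperplane) (simp_all add: zero_prod_def)
  then have "AE x in lebesgue. x \<notin> H 0 \<union> H (L / 2) \<union> H (- (L / 2))"
    unfolding negligible_iff_null_sets by (rule AE_not_in)
  then have "AE x in lebesgue. x \<in> {0..<L} \<times> {0..<L} \<longrightarrow> generic L (fst x) (snd x)"
    by eventually_elim (auto simp: H_def inner_prod_def generic_def abs_if split: if_splits)
  then show ?thesis unfolding AE_torus_iff .
qed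

text \<open>The variations are given by \<open>deriv\<close>, with uncontrolled values on the
  exceptional null set. Completeness of Lebesgue measure makes \<open>u\<close> measurable all the
  same.\<close>

lemma L_infinity_torusI:
  assumes g: "g \<in> borel_measurable (torus_measure L)" and ae: "AE x in torus_measure L. u x = g x"
    and C: "AE x in torus_measure L. \<bar>g x\<bar> \<le> C"
  shows "u \<in> L_infinity (torus_measure L)"
proof -
  define S where "S = {0..<L} \<times> {0..<L}"
  have S: "S \<in> sets lebesgue" unfolding S_def by (rule fundamental_domain_lebesgue)
  have "AE x in lebesgue. x \<in> S \<longrightarrow> u x = g x"
    using ae unfolding AE_torus_iff S_def .
  \<comment> \<open>Extension by zero moves the question to the whole plane, where the measure is
    the complete one.\<close>
  then have "AE x in lebesgue. (if x \<in> S then g x else 0) = (if x \<in> S then u x else 0)"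
    by eventually_elim auto
  moreover have "(\<lambda>x. if x \<in> S then g x else 0) \<in> borel_measurable lebesgue"
    unfolding borel_measurable_if[OF S] using g by (simp add: torus_measure_def S_def)
  ultimately have "(\<lambda>x. if x \<in> S then u x else 0) \<in> borel_measurable lebesgue"
    by (rule borel_measurable_AE[rotated])
  then have u: "u \<in> borel_measurable (torus_measure L)"
    unfolding borel_measurable_if[OF S] by (simp add: torus_measure_def S_def)
  have "AE x in torus_measure L. ereal \<bar>u x\<bar> \<le> ereal C" using ae C by eventually_elim auto
  then have "esssup (torus_measure L) (\<lambda>x. ereal \<bar>u x\<bar>) \<le> ereal C"
    using u by (intro esssup_I) auto
  also have "ereal C < \<infinity>" by simp
  finally show ?thesis using u by (simp add: L_infinity_def)
qed

lemma borel_measurable_torusI: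
  fixes h :: "real \<times> real \<Rightarrow> 'a::topological_space"
  assumes "h \<in> borel_measurable borel"
  shows "h \<in> borel_measurable (torus_measure L)"
  unfolding torus_measure_def
  by (intro measurable_restrict_space1 measurable_completion) (use assms in simp)

text \<open>The ends of the arc jump as functions of the pair, but they are Borel, and the integral
  is a difference of values of a continuous primitive at these ends.\<close>

lemma integral_short_arc_measurable:
  fixes w :: "real \<Rightarrow> 'a::euclidean_space"
  assumes w: "continuous_on UNIV w"
  shows "(\<lambda>x. integral {short_lo L (fst x) (snd x)..short_hi L (fst x) (snd x)} w)
    \<in> borel_measurable (torus_measure L)"
proof -
  \<comment> \<open>Clamping \<open>r\<close> to \<open>{0..2 * L}\<close> makes the primitive
    continuous on the whole line without changing it where the ends lie.\<close>
  define I where "I r = integral {0..min (2 * L) (max 0 r)} w" for r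
  have int: "w integrable_on {0..r}" for r
    by (intro integrable_continuous_real continuous_on_subset[OF w]) auto
  have [measurable]: "(fst :: real \<times> real \<Rightarrow> real) \<in> borel_measurable borel"
    "(snd :: real \<times> real \<Rightarrow> real) \<in> borel_measurable borel"
    by (intro borel_measurable_continuous_onI continuous_intros)+
  have [measurable]: "(\<lambda>x. short_lo L (fst x) (snd x)) \<in> borel_measurable borel"
    "(\<lambda>x. short_hi L (fst x) (snd x)) \<in> borel_measurable borel"
    unfolding short_lo_def short_hi_def lift_end_def by measurable
  have I: "I \<in> borel_measurable borel" if "0 \<le> L"
  proof (rule borel_measurable_continuous_onI)
    show "continuous_on UNIV I"
      unfolding I_def
      by (rule continuous_on_compose2[OF indefinite_integral_continuous_1[OF int[of "2 * L"]]])
        (use that in \<open>auto intro!: continuous_intros\<close>)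
  qed
  show ?thesis
  proof (cases "0 \<le> L")
    case True
    note [measurable] = I[OF True]
    have "(\<lambda>x. I (short_hi L (fst x) (snd x)) - I (short_lo L (fst x) (snd x))) \<in> borel_measurable borel"
      by measurable
    then have "(\<lambda>x. I (short_hi L (fst x) (snd x)) - I (short_lo L (fst x) (snd x)))
        \<in> borel_measurable (torus_measure L)" by (rule borel_measurable_torusI)
    moreover have "I (short_hi L s t) - I (short_lo L s t) = integral {short_lo L s t..short_hi L s t} w"
      if "s \<in> {0..<L}" "t \<in> {0..<L}" for s t
    proof -
      note B = short_arc_bounds[OF that]
      have "I (short_lo L s t) = integral {0..short_lo L s t} w"
        "I (short_hi L s t) = integral {0..short_hi L s t} w"
        using B by (auto simp: I_def)
      then show ?thesis
        using Henstock_Kurzweil_Integration.integral_combine[OF B(1,2) int] by (simp add: algebra_simps)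
    qed
    ultimately show ?thesis
      by (subst measurable_cong) (auto simp: torus_measure_def space_restrict_space)
  next
    case False
    then have "space (torus_measure L) = {}" by (auto simp: torus_measure_def space_restrict_space)
    then show ?thesis by (simp add: measurable_def)
  qed
qed

text \<open>Each form is a Borel expression in the velocities at \<open>s\<close> and
  \<open>t\<close> and in integrals of continuous functions over the short arc. That
  \<open>v\<close> vanishes nowhere makes the integrands with \<open>norm v\<close> in the
  denominator continuous.\<close>

lemma forms_measurable:
  fixes v y z :: "real \<Rightarrow> 'a::euclidean_space"
  assumes v: "continuous_on UNIV v" and y: "continuous_on UNIV y" and z: "continuous_on UNIV z"
    and nz: "\<And>x. v x \<noteq> 0"
  shows "(\<lambda>x. defect0 \<alpha> (short_lo L (fst x) (snd x)) (short_hi L (fst x) (snd x)) v powr p) \<in> borel_measurable (torus_measure L)"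
    "(\<lambda>x. form1 \<alpha> p (short_lo L (fst x) (snd x)) (short_hi L (fst x) (snd x)) (fst x) (snd x) v y)
       \<in> borel_measurable (torus_measure L)"
    "(\<lambda>x. form2 \<alpha> p (short_lo L (fst x) (snd x)) (short_hi L (fst x) (snd x)) (fst x) (snd x) v y z)
       \<in> borel_measurable (torus_measure L)"
proof -
  note c = v y z continuous_on_norm[OF v] continuous_on_norm_d1[OF v y nz] continuous_on_norm_d1[OF v z nz]
    continuous_on_norm_d2[OF v y z nz]
  have [measurable]: "(\<lambda>x. w (fst x)) \<in> borel_measurable (torus_measure L)"
    "(\<lambda>x. w (snd x)) \<in> borel_measurable (torus_measure L)" if "w \<in> {v, y, z}" for w
    using that v y z
    by (auto intro!: borel_measurable_torusI borel_measurable_continuous_onI continuous_intros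
        intro: continuous_on_compose2[of UNIV])
  note [measurable] = c[THEN integral_short_arc_measurable, of L, unfolded norm_d1_def norm_d2_def]
  show "(\<lambda>x. defect0 \<alpha> (short_lo L (fst x) (snd x)) (short_hi L (fst x) (snd x)) v powr p) \<in> borel_measurable (torus_measure L)"
    unfolding defect0_def by measurable
  show "(\<lambda>x. form1 \<alpha> p (short_lo L (fst x) (snd x)) (short_hi L (fst x) (snd x)) (fst x) (snd x) v y)
       \<in> borel_measurable (torus_measure L)"
    unfolding form1_def defect0_def defect1_def powr_d1_def norm_d1_def speed2_d1_def powr_slope_def
    by measurable
  show "(\<lambda>x. form2 \<alpha> p (short_lo L (fst x) (snd x)) (short_hi L (fst x) (snd x)) (fst x) (snd x) v y z)
       \<in> borel_measurable (torus_measure L)"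
    unfolding form2_def defect0_def defect1_def defect2_def powr_d1_def powr_d2_def norm_d1_def norm_d2_def
      speed2_d1_def speed2_d2_def powr_slope_def
    by measurable
qed

theorem corollary1p2:
  fixes L \<alpha> p :: real and f \<phi> \<psi> :: "real \<Rightarrow> real ^ 'n"
  assumes "0 < L" and "0 < \<alpha>" and "1 \<le> p" and "2 / p \<le> \<alpha>" and "\<alpha> \<le> 2"
    and "arclength_parametrization L f" and "inj_on f {0..<L}"
    and "C1_holder L (\<alpha> / 2) f" and "C1_holder L (\<alpha> / 2) \<phi>" and "C1_holder L (\<alpha> / 2) \<psi>"
    and "bi_lipschitz L f"
  shows "(\<lambda>(s, t). energy_density L \<alpha> p f s t) \<in> L_infinity (torus_measure L)
    \<and> (AE (s, t) in torus_measure L. first_variation_exists (\<lambda>g. energy_form L \<alpha> p g s t) f \<phi>)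
    \<and> (\<lambda>(s, t). energy_G L \<alpha> p f \<phi> s t) \<in> L_infinity (torus_measure L)
    \<and> (AE (s, t) in torus_measure L.
          second_variation_exists (\<lambda>g. energy_form L \<alpha> p g s t) f \<phi> \<psi>)
    \<and> (\<lambda>(s, t). energy_H L \<alpha> p f \<phi> \<psi> s t) \<in> L_infinity (torus_measure L)"
proof -
  note L = assms(1) and \<alpha> = assms(2) and p = assms(3)
  note closed = assms(8-10)[THEN C1_holder_closed_C1]
  have cont: "continuous_on UNIV (velocity f)" "continuous_on UNIV (velocity \<phi>)" "continuous_on UNIV (velocity \<psi>)"
    using closed by (simp_all add: closed_C1_def)
  have nz: "velocity f x \<noteq> 0" for x
    using assms(6) by (auto simp: arclength_parametrization_def velocity_def dest!: spec[of _ x])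
  let ?a = "\<lambda>x. short_lo L (fst x) (snd x)" and ?b = "\<lambda>x. short_hi L (fst x) (snd x)"
  obtain c M K where c: "0 < c" and T: "\<And>s t. generic L s t \<Longrightarrow> good L s t (velocity f) \<and>
       tame c M (K * (short_hi L s t - short_lo L s t) powr (\<alpha> / 2)) (short_lo L s t) (short_hi L s t)
         (velocity f) (velocity \<psi>) (velocity \<phi>) \<and>
       (velocity f s, velocity \<psi> s, velocity \<phi> s) \<in> triples c M \<and>
       (velocity f t, velocity \<psi> t, velocity \<phi> t) \<in> triples c M"
    using bi_lipschitz_tame[OF L \<alpha> assms(6,11,8-10)] by blast
  obtain C where C: "\<And>a b s t (v :: real \<Rightarrow> real ^ 'n) y z.
    \<lbrakk>tame c M (K * (b - a) powr (\<alpha> / 2)) a b v y z; (v s, y s, z s) \<in> triples c M;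
     (v t, y t, z t) \<in> triples c M\<rbrakk> \<Longrightarrow>
    \<bar>defect0 \<alpha> a b v powr p\<bar> \<le> C \<and> \<bar>form1 \<alpha> p a b s t v y\<bar> \<le> C \<and> \<bar>form2 \<alpha> p a b s t v y z\<bar> \<le> C"
    using forms_bound[OF \<alpha> p c] by blast
  have swap: "(v, z, y) \<in> triples c M" if "(v, y, z) \<in> triples c M" for v y z :: "real ^ 'n"
    using that by (auto simp: triples_def)
  have bounds: "\<bar>defect0 \<alpha> (short_lo L s t) (short_hi L s t) (velocity f) powr p\<bar> \<le> C"
    "\<bar>form1 \<alpha> p (short_lo L s t) (short_hi L s t) s t (velocity f) (velocity \<phi>)\<bar> \<le> C"
    "\<bar>form2 \<alpha> p (short_lo L s t) (short_hi L s t) s t (velocity f) (velocity \<psi>) (velocity \<phi>)\<bar> \<le> C"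
    if "generic L s t" for s t
    \<comment> \<open>Two instances: \<open>form2\<close> is wanted with \<psi> before \<phi>,
      whereas \<open>form1\<close> is wanted in the direction \<phi>.\<close>
    using C[of "short_hi L s t" "short_lo L s t" "velocity f" "velocity \<psi>" "velocity \<phi>" s t]
      C[of "short_hi L s t" "short_lo L s t" "velocity f" "velocity \<phi>" "velocity \<psi>" s t]
      T[OF that] swap tame_swap by blast+
  note V = energy_variations[OF L \<alpha> p _ closed(1) _ closed(2,3)]
  note gen = AE_torus_generic[of L]
  show ?thesis
  proof (intro conjI)
    show "(\<lambda>(s, t). energy_density L \<alpha> p f s t) \<in> L_infinity (torus_measure L)"
    proof (rule L_infinity_torusI[OF forms_measurable(1)[OF cont(1,2,3) nz]])
      show "AE x in torus_measure L. (case x of (s, t) \<Rightarrow> energy_density L \<alpha> p f s t)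
          = defect0 \<alpha> (?a x) (?b x) (velocity f) powr p"
        using gen by eventually_elim (auto simp: energy_density_good closed T)
      show "AE x in torus_measure L. \<bar>defect0 \<alpha> (?a x) (?b x) (velocity f) powr p\<bar> \<le> C"
        using gen by eventually_elim (rule bounds)
    qed
    show "AE (s, t) in torus_measure L. first_variation_exists (\<lambda>g. energy_form L \<alpha> p g s t) f \<phi>"
      using gen by eventually_elim (auto intro: V(1) simp: T)
    show "(\<lambda>(s, t). energy_G L \<alpha> p f \<phi> s t) \<in> L_infinity (torus_measure L)"
    proof (rule L_infinity_torusI[OF forms_measurable(2)[OF cont(1,2,3) nz]])
      show "AE x in torus_measure L. (case x of (s, t) \<Rightarrow> energy_G L \<alpha> p f \<phi> s t)
          = form1 \<alpha> p (?a x) (?b x) (fst x) (snd x) (velocity f) (velocity \<phi>)"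
        using gen by eventually_elim (auto simp: V(2) T)
      show "AE x in torus_measure L. \<bar>form1 \<alpha> p (?a x) (?b x) (fst x) (snd x) (velocity f) (velocity \<phi>)\<bar> \<le> C"
        using gen by eventually_elim (rule bounds)
    qed
    show "AE (s, t) in torus_measure L. second_variation_exists (\<lambda>g. energy_form L \<alpha> p g s t) f \<phi> \<psi>"
      using gen by eventually_elim (auto intro: V(3) simp: T)
    show "(\<lambda>(s, t). energy_H L \<alpha> p f \<phi> \<psi> s t) \<in> L_infinity (torus_measure L)"
    proof (rule L_infinity_torusI[OF forms_measurable(3)[OF cont(1,3,2) nz]])
      show "AE x in torus_measure L. (case x of (s, t) \<Rightarrow> energy_H L \<alpha> p f \<phi> \<psi> s t)
          = form2 \<alpha> p (?a x) (?b x) (fst x) (snd x) (velocity f) (velocity \<psi>) (velocity \<phi>)"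
        using gen by eventually_elim (auto simp: V(4) T)
      show "AE x in torus_measure L.
          \<bar>form2 \<alpha> p (?a x) (?b x) (fst x) (snd x) (velocity f) (velocity \<psi>) (velocity \<phi>)\<bar> \<le> C"
        using gen by eventually_elim (rule bounds)
    qed
  qed
qed

end
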